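(* Let $d,q\ge 1$ be integers, let $\Lambda=\{\Lambda(A): A\in\mathcal{S}\}$ be an infinitely divisible random measure on $\mathbb{R}^d$, where $\mathcal{S}$ is the $\delta$-ring of bounded Borel subsets of $\mathbb{R}^d$, and let $f_t:\mathbb{R}^d\to\mathbb{R}$ be $\Lambda$-integrable for every $t\in\mathbb{R}^q$. Define the random field $X=\{X(t): t\in\mathbb{R}^q\}$ by $$X(t)=\int_{\mathbb{R}^d} f_t(x)\,\Lambda(dx),\qquad t\in\mathbb{R}^q.$$ Then $X$ is infinitely divisible, that is, for all $n\in\mathbb{N}$ and all $t_1,\dots,t_n\in\mathbb{R}^q$, the law of the random vector $(X(t_1),\dots,X(t_n))^{\mathsf{T}}$ is an infinitely divisible probability measure on $\mathbb{R}^n$.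
   Context: **Infinitely divisible random measure.** Let $\mathcal{B}(\mathbb{R}^d)$ denote the Borel sets of $\mathbb{R}^d$ and let $\mathcal{S}$ be the $\delta$-ring (ring closed under countable intersections) of bounded Borel subsets of $\mathbb{R}^d$. A real-valued stochastic process $\Lambda=\{\Lambda(A): A\in\mathcal{S}\}$ on a probability space is called an infinitely divisible random measure if: (1) (independently scattered) for every sequence $\{A_n\}_{n\in\mathbb{N}}\subset\mathcal{S}$ of disjoint sets, the random variables $\Lambda(A_n)$, $n\in\mathbb{N}$, are independent; (2) ($\sigma$-additive) for every sequence $\{A_n\}_{n\in\mathbb{N}}\subset\mathcal{S}$ of disjoint sets with $\bigcup_n A_n\in\mathcal{S}$, one has $\Lambda(\bigcup_n A_n)=\sum_n\Lambda(A_n)$ almost surely; (3) for each $A\in\mathcal{S}$, $\Lambda(A)$ is an infinitely divisible random variable, i.e. for every $n\ge1$ it has the law of a sum of $n$ independent identically distributed random variables. **Characteristic triplet.** For $A\in\mathcal{S}$ the cumulant function $C_{\Lambda(A)}(t)=\ln(\mathbb{E}e^{it\Lambda(A)})$, $t\in\mathbb{R}$, is given by the Lévy–Khintchine representation $$C_{\Lambda(A)}(t)=it\,a(A)-\tfrac12 t^2 b(A)+\int_{\mathbb{R}}\left(e^{itr}-1-it\tau(r)\right)F(dr,A),\qquad \tau(r)=r\,\mathbf{1}_{[-1,1]}(r),$$ where $a$ is a $\sigma$-additive (real-valued) set function on $\mathcal{S}$, $b$ is a measure on $\mathcal{B}(\mathbb{R}^d)$, and $F$ (the generalized Lévy measure)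 is such that $F(D,\cdot)$ is a measure on $\mathcal{B}(\mathbb{R}^d)$ for each fixed $D\in\mathcal{B}(\mathbb{R})$ and $F(\cdot,A)$ is a Lévy measure on $\mathcal{B}(\mathbb{R})$ for each fixed $A\in\mathcal{S}$, i.e. $F(\{0\},A)=0$ and $\int_{\mathbb{R}}\min\{1,r^2\}\,F(dr,A)<\infty$. The triple $(a,b,F)$ is called the characteristic triplet of $\Lambda$. **Control measure.** With $|a|=a^++a^-$ the total variation of $a$, the control measure $\lambda$ of $\Lambda$ is the measure (extended from $\mathcal{S}$ to $\mathcal{B}(\mathbb{R}^d)$) with $$\lambda(A)=|a|(A)+b(A)+\int_{\mathbb{R}}\min\{1,r^2\}\,F(dr,A),\qquad A\in\mathcal{S}.$$ **Integral.** A simple function is $g=\sum_{j=1}^k c_j\mathbf{1}_{A_j}$ with $c_j\in\mathbb{R}$ and disjoint $A_j\in\mathcal{S}$; for a Borel set $B\subset\mathbb{R}^d$ put $\int_B g(x)\,\Lambda(dx)=\sum_{j=1}^k c_j\Lambda(A_j\cap B)$. A function $f:\mathbb{R}^d\to\mathbb{R}$ is $\Lambda$-integrable if there is a sequence of simple functions $\{f^{(n)}\}_{n\in\mathbb{N}}$ such that (i) $f^{(n)}\to f$ $\lambda$-almost everywhere, and (ii) for every Borel set $B\subset\mathbb{R}^d$, the sequence $\{\int_B f^{(n)}(x)\,\Lambda(dx)\}_{n\in\mathbb{N}}$ converges in probability. In that case $\int_{\mathbb{R}^d}f(x)\,\Lambda(dx)$ is defined as the limit in probability of $\int_{\mathbb{R}^d}f^{(n)}(x)\,\Lambda(dx)$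 as $n\to\infty$. **Infinite divisibility on $\mathbb{R}^n$.** A probability measure $\mu$ on $\mathbb{R}^n$ is infinitely divisible if for every integer $m\ge1$ there is a probability measure $\mu_m$ on $\mathbb{R}^n$ whose $m$-fold convolution equals $\mu$. *)

theory Defs
  imports "HOL-Probability.Probability"
begin

section \<open>Infinite divisibility\<close>

(* The sample space nat => real is no restriction: the law of a sum of n i.i.d. random
   variables only depends on their joint law on the first n coordinates. *)
definition infinitely_divisible_rv :: "'w measure \<Rightarrow> ('w \<Rightarrow> real) \<Rightarrow> bool" where
  "infinitely_divisible_rv M Y \<longleftrightarrow>
     (\<forall>n\<ge>1::nat. \<exists>(N :: (nat \<Rightarrow> real) measure) Z. prob_space N \<and>
        prob_space.indep_vars N (\<lambda>_. borel :: real measure) Z {..<n} \<and>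
        (\<forall>i<n. distr N borel (Z i) = distr N borel (Z 0)) \<and>
        distr M borel Y = distr N borel (\<lambda>\<omega>. \<Sum>i<n. Z i \<omega>))"

primrec convolution_power ::
  "nat \<Rightarrow> 'a::ordered_euclidean_space measure \<Rightarrow> 'a measure" where
  "convolution_power 0 \<mu> = return borel 0"
| "convolution_power (Suc m) \<mu> = (\<mu> \<star> convolution_power m \<mu>)"

definition infinitely_divisible :: "'a::ordered_euclidean_space measure \<Rightarrow> bool" where
  "infinitely_divisible \<mu> \<longleftrightarrow>
     prob_space \<mu> \<and> sets \<mu> = sets borel \<and>
     (\<forall>m\<ge>1. \<exists>\<nu>. prob_space \<nu> \<and> sets \<nu> = sets borel \<and> convolution_power m \<nu> = \<mu>)"


section \<open>Infinitely divisible random measures\<close>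

definition bounded_borel :: "'a::euclidean_space set set" where
  "bounded_borel = {A \<in> sets borel. bounded A}"

definition infinitely_divisible_random_measure ::
  "'w measure \<Rightarrow> ('a::euclidean_space set \<Rightarrow> 'w \<Rightarrow> real) \<Rightarrow> bool" where
  "infinitely_divisible_random_measure M \<Lambda> \<longleftrightarrow>
     prob_space M \<and>
     (\<forall>A\<in>bounded_borel. \<Lambda> A \<in> borel_measurable M) \<and>
     (\<forall>A :: nat \<Rightarrow> 'a set. range A \<subseteq> bounded_borel \<longrightarrow> disjoint_family A \<longrightarrow>
        prob_space.indep_vars M (\<lambda>_. borel) (\<lambda>n. \<Lambda> (A n)) UNIV) \<and>
     (\<forall>A :: nat \<Rightarrow> 'a set. range A \<subseteq> bounded_borel \<longrightarrow> disjoint_family A \<longrightarrow>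
        (\<Union>n. A n) \<in> bounded_borel \<longrightarrow>
        (AE \<omega> in M. (\<lambda>n. \<Lambda> (A n) \<omega>) sums \<Lambda> (\<Union>n. A n) \<omega>)) \<and>
     (\<forall>A\<in>bounded_borel. infinitely_divisible_rv M (\<Lambda> A))"


section \<open>Characteristic triplet and control measure\<close>

definition levy_measure :: "real measure \<Rightarrow> bool" where
  "levy_measure \<nu> \<longleftrightarrow>
     sets \<nu> = sets borel \<and> emeasure \<nu> {0} = 0 \<and>
     (\<integral>\<^sup>+ r. ennreal (min 1 (r\<^sup>2)) \<partial>\<nu>) < \<infinity>"

(* The logarithm of the characteristic function is the distinguished one, i.e. the unique
   continuous branch vanishing at 0, and not the principal value Ln. *)
definition is_cumulant :: "'w measure \<Rightarrow> ('w \<Rightarrow> real) \<Rightarrow> (real \<Rightarrow> complex) \<Rightarrow> bool" where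
  "is_cumulant M Y C \<longleftrightarrow>
     continuous_on UNIV C \<and> C 0 = 0 \<and> (\<forall>t. exp (C t) = char (distr M borel Y) t)"

definition levy_trunc :: "real \<Rightarrow> real" where
  "levy_trunc r = r * indicator {-1..1} r"

(* F A is the measure F(., A); the finiteness of b(A) for bounded A is implicit in b(A) being
   the Gaussian variance of a real random variable. *)
definition characteristic_triplet ::
  "'w measure \<Rightarrow> ('a::euclidean_space set \<Rightarrow> 'w \<Rightarrow> real) \<Rightarrow>
     ('a set \<Rightarrow> real) \<Rightarrow> 'a measure \<Rightarrow> ('a set \<Rightarrow> real measure) \<Rightarrow> bool" where
  "characteristic_triplet M \<Lambda> a b F \<longleftrightarrow>
     (\<forall>A :: nat \<Rightarrow> 'a set. range A \<subseteq> bounded_borel \<longrightarrow> disjoint_family A \<longrightarrow>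
        (\<Union>n. A n) \<in> bounded_borel \<longrightarrow> (\<lambda>n. a (A n)) sums a (\<Union>n. A n)) \<and>
     sets b = sets borel \<and> (\<forall>A\<in>bounded_borel. emeasure b A < \<infinity>) \<and>
     (\<forall>D\<in>sets borel. measure_space UNIV (sets borel) (\<lambda>A. emeasure (F A) D)) \<and>
     (\<forall>A\<in>bounded_borel. levy_measure (F A)) \<and>
     (\<forall>A\<in>bounded_borel. is_cumulant M (\<Lambda> A)
        (\<lambda>t. \<i> * t * a A - t\<^sup>2 * measure b A / 2 +
             (CLINT r|F A. iexp (t * r) - 1 - \<i> * t * levy_trunc r)))"

(* |a| = a^+ + a^-, where a^+ and a^- are the upper and the lower variation of a; ennreal
   sends negative numbers to 0, which is harmless since a({}) = 0 enters both suprema. *)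
definition total_variation :: "('a::euclidean_space set \<Rightarrow> real) \<Rightarrow> 'a set \<Rightarrow> ennreal" where
  "total_variation a A =
     (SUP B\<in>{B \<in> bounded_borel. B \<subseteq> A}. ennreal (a B)) +
     (SUP B\<in>{B \<in> bounded_borel. B \<subseteq> A}. ennreal (- a B))"

(* The triplet, and hence the control measure, exists and is unique for every infinitely
   divisible random measure, so that this relation determines the control measure. *)
definition control_measure ::
  "'w measure \<Rightarrow> ('a::euclidean_space set \<Rightarrow> 'w \<Rightarrow> real) \<Rightarrow> 'a measure \<Rightarrow> bool" where
  "control_measure M \<Lambda> \<kappa> \<longleftrightarrow>
     sets \<kappa> = sets borel \<and>
     (\<exists>a b F. characteristic_triplet M \<Lambda> a b F \<and>
        (\<forall>A\<in>bounded_borel. emeasure \<kappa> A =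
           total_variation a A + emeasure b A + (\<integral>\<^sup>+ r. ennreal (min 1 (r\<^sup>2)) \<partial>F A)))"


section \<open>Stochastic integral\<close>

(* A simple function is given by a list of its coefficients and sets. Up to null events, its
   integral depends only on the function and not on the list. *)
type_synonym 'a simple = "(real \<times> 'a set) list"

definition is_simple :: "'a::euclidean_space simple \<Rightarrow> bool" where
  "is_simple s \<longleftrightarrow>
     (\<forall>j<length s. snd (s ! j) \<in> bounded_borel) \<and>
     disjoint_family_on (\<lambda>j. snd (s ! j)) {..<length s}"

definition simple_fun :: "'a simple \<Rightarrow> 'a \<Rightarrow> real" where
  "simple_fun s x = (\<Sum>j<length s. fst (s ! j) * indicator (snd (s ! j)) x)"

definition simple_random_integral ::
  "('a set \<Rightarrow> 'w \<Rightarrow> real) \<Rightarrow> 'a set \<Rightarrow> 'a simple \<Rightarrow> 'w \<Rightarrow> real" where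
  "simple_random_integral \<Lambda> B s \<omega> = (\<Sum>j<length s. fst (s ! j) * \<Lambda> (snd (s ! j) \<inter> B) \<omega>)"

definition converges_in_probability ::
  "'w measure \<Rightarrow> (nat \<Rightarrow> 'w \<Rightarrow> real) \<Rightarrow> ('w \<Rightarrow> real) \<Rightarrow> bool" where
  "converges_in_probability M Y Z \<longleftrightarrow>
     Z \<in> borel_measurable M \<and>
     (\<forall>\<epsilon>>0. (\<lambda>n. measure M {\<omega> \<in> space M. \<bar>Y n \<omega> - Z \<omega>\<bar> > \<epsilon>}) \<longlonglongrightarrow> 0)"

definition approximating_sequence ::
  "'w measure \<Rightarrow> ('a::euclidean_space set \<Rightarrow> 'w \<Rightarrow> real) \<Rightarrow> ('a \<Rightarrow> real) \<Rightarrow>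
     (nat \<Rightarrow> 'a simple) \<Rightarrow> bool" where
  "approximating_sequence M \<Lambda> f s \<longleftrightarrow>
     (\<forall>n. is_simple (s n)) \<and>
     (\<exists>\<kappa>. control_measure M \<Lambda> \<kappa> \<and> (AE x in \<kappa>. (\<lambda>n. simple_fun (s n) x) \<longlonglongrightarrow> f x)) \<and>
     (\<forall>B\<in>sets borel. \<exists>Z. converges_in_probability M (\<lambda>n. simple_random_integral \<Lambda> B (s n)) Z)"

definition random_integrable ::
  "'w measure \<Rightarrow> ('a::euclidean_space set \<Rightarrow> 'w \<Rightarrow> real) \<Rightarrow> ('a \<Rightarrow> real) \<Rightarrow> bool" where
  "random_integrable M \<Lambda> f \<longleftrightarrow> (\<exists>s. approximating_sequence M \<Lambda> f s)"

(* "Z is a version of the integral of f": as a limit in probability, the integral is only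
   determined up to null events. *)
definition has_random_integral ::
  "'w measure \<Rightarrow> ('a::euclidean_space set \<Rightarrow> 'w \<Rightarrow> real) \<Rightarrow> ('a \<Rightarrow> real) \<Rightarrow> ('w \<Rightarrow> real) \<Rightarrow> bool" where
  "has_random_integral M \<Lambda> f Z \<longleftrightarrow>
     (\<exists>s. approximating_sequence M \<Lambda> f s \<and>
          converges_in_probability M (\<lambda>n. simple_random_integral \<Lambda> UNIV (s n)) Z)"

end

theory Submission
  imports Defs
begin

text \<open>The integrals \<open>X(t\<^sub>i)\<close> are limits in probability of integrals of simple functions, so
along a subsequence the vectors of simple integrals converge almost surely to the vector of the
\<open>X(t\<^sub>i)\<close>. Fix \<open>m \<ge> 1\<close>. It suffices that the vectors of simple integrals have laws with an
\<open>m\<close>-th convolution root, and that the existence of such a root survives almost sure limits.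

For the first point (\<open>has_convolution_root_simple_random_integrals\<close>), the finitely many sets that
occur in the simple functions are refined to disjoint ones \<open>B\<^sub>k\<close>. Additivity of \<open>\<Lambda>\<close> turns the
vector into \<open>\<Sum>\<^sub>k \<Lambda>(B\<^sub>k) v\<^sub>k\<close> with deterministic vectors \<open>v\<^sub>k\<close>, a sum of independent terms. Each
\<open>\<Lambda>(B\<^sub>k)\<close> is infinitely divisible, and having an \<open>m\<close>-th root is preserved by linear images and by
convolution.

The second point (\<open>has_convolution_root_AE_limit\<close>) is a compactness argument. If \<open>m\<close> independent
copies of a vector all have inner product at least \<open>a\<close> with \<open>u\<close>, then their sum has inner
product at least \<open>ma\<close> with \<open>u\<close>; hence the tails of the roots are controlled by the tails of the
converging sequence (\<open>convolution_power_tail\<close>), and the roots are tight. A tight sequence of laws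
has a subsequence that is realised by almost surely convergent vectors (\<open>tight_coupling\<close>); sums
of \<open>m\<close> independent copies of these vectors then converge as well, and the law of the limit of
the sums is both the law in question and an \<open>m\<close>-fold convolution.

The coupling in several dimensions is reduced to the theorems of Helly and Skorohod on the real
line: a space-filling curve \<open>\<gamma>\<close> of the cube has a Borel measurable section \<open>c\<close>, laws on the cube
are moved to the line by \<open>c\<close>, and the convergent random variables found there are moved back by the
continuous map \<open>\<gamma>\<close>.\<close>

section \<open>Convolution powers and their roots\<close>

definition has_convolution_root :: "nat \<Rightarrow> 'a::ordered_euclidean_space measure \<Rightarrow> bool" where
  "has_convolution_root m \<mu> \<longleftrightarrow>
     (\<exists>\<nu>. prob_space \<nu> \<and> sets \<nu> = sets borel \<and> convolution_power m \<nu> = \<mu>)"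

lemma sets_convolution_power [simp, measurable_cong]: "sets (convolution_power m \<nu>) = sets borel"
  by (cases m) simp_all

lemma prob_space_convolution:
  assumes "prob_space \<mu>" "prob_space \<nu>" and [measurable_cong]: "sets \<mu> = sets borel" "sets \<nu> = sets borel"
  shows "prob_space (\<mu> \<star> \<nu>)"
proof -
  interpret \<mu>: prob_space \<mu> by fact
  interpret \<nu>: prob_space \<nu> by fact
  interpret pair_prob_space \<mu> \<nu> ..
  show ?thesis
    unfolding convolution_def by (rule prob_space_distr) measurable
qed

lemma prob_space_convolution_power:
  assumes "prob_space \<nu>" "sets \<nu> = sets borel"
  shows "prob_space (convolution_power m \<nu>)"
  by (induction m) (use assms in \<open>simp_all add: prob_space_return prob_space_convolution\<close>)

lemma return_0_convolution:
  assumes "prob_space \<nu>" "sets \<nu> = sets borel"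
  shows "(return borel 0 \<star> \<nu>) = \<nu>"
proof (rule measure_eqI)
  interpret prob_space \<nu> by fact
  fix A assume "A \<in> sets (return borel 0 \<star> \<nu>)"
  then have A [measurable]: "A \<in> sets borel" by simp
  have sp: "space \<nu> = space borel" using assms(2) by (rule sets_eq_imp_space_eq)
  have "emeasure (return borel 0 \<star> \<nu>) A = (\<integral>\<^sup>+x. emeasure \<nu> {a. a + x \<in> A} \<partial>return borel 0)"
    using A assms sp
    by (intro convolution_emeasure)
      (auto simp: prob_space.finite_measure prob_space_return finite_measure_axioms)
  also have "\<dots> = emeasure \<nu> A"
  proof (subst nn_integral_return)
    have "(\<lambda>x. emeasure \<nu> {a. a + x \<in> A}) = (\<lambda>x. \<integral>\<^sup>+y. indicator A (y + x) \<partial>\<nu>)"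
    proof
      fix x :: 'a
      have "emeasure \<nu> {a. a + x \<in> A} = (\<integral>\<^sup>+y. indicator {a. a + x \<in> A} y \<partial>\<nu>)"
        by (rule nn_integral_indicator[symmetric]) (simp add: assms)
      then show "emeasure \<nu> {a. a + x \<in> A} = (\<integral>\<^sup>+y. indicator A (y + x) \<partial>\<nu>)"
        by (simp add: indicator_def)
    qed
    moreover have "(\<lambda>x. \<integral>\<^sup>+y. indicator A (y + x) \<partial>\<nu>) \<in> borel_measurable borel"
      by (rule borel_measurable_nn_integral) (use assms in measurable)
    ultimately show "(\<lambda>x. emeasure \<nu> {a. a + x \<in> A}) \<in> borel_measurable borel"
      by simp
  qed auto
  finally show "emeasure (return borel 0 \<star> \<nu>) A = emeasure \<nu> A" .
qed (simp add: assms)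

lemma convolution_power_return_0: "convolution_power m (return borel 0) = return borel 0"
  by (induction m) (simp_all add: return_0_convolution prob_space_return)

text \<open>Convolution is associative and commutative, so the factors of an alternating product can be sorted.\<close>

lemma convolution_power_convolution:
  assumes "prob_space \<mu>" "prob_space \<nu>" "sets \<mu> = sets borel" "sets \<nu> = sets borel"
  shows "convolution_power m (\<mu> \<star> \<nu>) = (convolution_power m \<mu> \<star> convolution_power m \<nu>)"
proof (induction m)
  case 0
  show ?case by (simp add: return_0_convolution prob_space_return)
next
  case (Suc m)
  note fin = prob_space.finite_measure[OF assms(1)] prob_space.finite_measure[OF assms(2)]
    prob_space.finite_measure[OF prob_space_convolution_power[OF assms(1,3)]]
    prob_space.finite_measure[OF prob_space_convolution_power[OF assms(2,4)]]
  let ?P = "convolution_power m \<mu>" and ?Q = "convolution_power m \<nu>"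
  have "((\<mu> \<star> \<nu>) \<star> (?P \<star> ?Q)) = (\<mu> \<star> (\<nu> \<star> (?P \<star> ?Q)))"
    by (rule convolution_associative[symmetric]) (simp_all add: fin assms convolution_finite)
  also have "(\<nu> \<star> (?P \<star> ?Q)) = ((\<nu> \<star> ?P) \<star> ?Q)"
    by (rule convolution_associative) (simp_all add: fin assms)
  also have "(\<nu> \<star> ?P) = (?P \<star> \<nu>)"
    by (rule convolution_commutative) (simp_all add: fin assms)
  also have "((?P \<star> \<nu>) \<star> ?Q) = (?P \<star> (\<nu> \<star> ?Q))"
    by (rule convolution_associative[symmetric]) (simp_all add: fin assms)
  also have "(\<mu> \<star> (?P \<star> (\<nu> \<star> ?Q))) = ((\<mu> \<star> ?P) \<star> (\<nu> \<star> ?Q))"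
    by (rule convolution_associative) (simp_all add: fin assms convolution_finite)
  finally show ?case using Suc by simp
qed

lemma linear_borel_measurable:
  fixes f :: "'a::euclidean_space \<Rightarrow> 'b::euclidean_space"
  assumes "linear f"
  shows "f \<in> borel_measurable borel"
  using assms by (intro borel_measurable_continuous_onI linear_continuous_on linear_conv_bounded_linear[THEN iffD1])

lemma distr_convolution_linear:
  fixes f :: "'a::ordered_euclidean_space \<Rightarrow> 'b::ordered_euclidean_space"
  assumes f: "linear f" and "prob_space \<mu>" "prob_space \<nu>"
    and [measurable_cong]: "sets \<mu> = sets borel" "sets \<nu> = sets borel"
  shows "distr (\<mu> \<star> \<nu>) borel f = (distr \<mu> borel f \<star> distr \<nu> borel f)"
proof -
  interpret \<nu>: prob_space \<nu> by fact
  have [measurable]: "f \<in> borel_measurable borel"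
    using f by (rule linear_borel_measurable)
  interpret \<nu>': prob_space "distr \<nu> borel f"
    by (rule \<nu>.prob_space_distr) measurable
  have "distr (\<mu> \<star> \<nu>) borel f = distr (\<mu> \<Otimes>\<^sub>M \<nu>) borel (\<lambda>(x, y). f (x + y))"
    unfolding convolution_def
    by (subst distr_distr) (auto simp: comp_def split_beta')
  also have "\<dots> = distr (\<mu> \<Otimes>\<^sub>M \<nu>) borel (\<lambda>(x, y). f x + f y)"
    using f by (simp add: linear_add)
  also have "\<dots> = (distr \<mu> borel f \<star> distr \<nu> borel f)"
    unfolding convolution_def
    by (subst pair_measure_distr; (subst distr_distr)?)
      (auto simp: comp_def split_beta' \<nu>'.sigma_finite_measure_axioms)
  finally show ?thesis .
qed

lemma distr_convolution_power_linear:
  fixes f :: "'a::ordered_euclidean_space \<Rightarrow> 'b::ordered_euclidean_space"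
  assumes f: "linear f" and "prob_space \<nu>" and "sets \<nu> = sets borel"
  shows "distr (convolution_power m \<nu>) borel f = convolution_power m (distr \<nu> borel f)"
proof (induction m)
  case 0
  have "f \<in> borel_measurable borel"
    using f by (rule linear_borel_measurable)
  then show ?case using linear_0[OF f] by (simp add: distr_return)
next
  case (Suc m)
  then show ?case
    by (simp add: distr_convolution_linear f assms prob_space_convolution_power)
qed

lemma (in prob_space) indep_var_sum_vector:
  fixes Y :: "'i \<Rightarrow> 'a \<Rightarrow> 'b::euclidean_space"
  assumes "finite I" "i \<notin> I" and indep: "indep_vars (\<lambda>_. borel) Y (insert i I)"
  shows "indep_var borel (Y i) borel (\<lambda>\<omega>. \<Sum>j\<in>I. Y j \<omega>)"
proof -
  have "indep_var
      borel ((\<lambda>f. f i) \<circ> (\<lambda>\<omega>. restrict (\<lambda>i. Y i \<omega>) {i}))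
      borel ((\<lambda>f. \<Sum>j\<in>I. f j) \<circ> (\<lambda>\<omega>. restrict (\<lambda>i. Y i \<omega>) I))"
    using assms by (intro indep_var_compose[OF indep_var_restrict[OF indep]]) auto
  also have "(\<lambda>f. f i) \<circ> (\<lambda>\<omega>. restrict (\<lambda>i. Y i \<omega>) {i}) = Y i"
    by auto
  also have "(\<lambda>f. \<Sum>j\<in>I. f j) \<circ> (\<lambda>\<omega>. restrict (\<lambda>i. Y i \<omega>) I) = (\<lambda>\<omega>. \<Sum>j\<in>I. Y j \<omega>)"
    by (auto cong: rev_conj_cong)
  finally show ?thesis .
qed

text \<open>Splitting off one summand of an independent family is what makes inductions over the number of
summands produce convolutions.\<close>

lemma (in prob_space) distr_sum_insert:
  fixes Y :: "'i \<Rightarrow> 'a \<Rightarrow> 'b::ordered_euclidean_space"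
  assumes I: "finite I" "i \<notin> I" and indep: "indep_vars (\<lambda>_. borel) Y (insert i I)"
  shows "distr M borel (\<lambda>\<omega>. \<Sum>j\<in>insert i I. Y j \<omega>) =
    (distr M borel (Y i) \<star> distr M borel (\<lambda>\<omega>. \<Sum>j\<in>I. Y j \<omega>))"
proof -
  have Y: "Y j \<in> borel_measurable M" if "j \<in> insert i I" for j
    using indep that unfolding indep_vars_def by blast
  have "distr M borel (\<lambda>\<omega>. Y i \<omega> + (\<Sum>j\<in>I. Y j \<omega>)) =
      (distr M borel (Y i) \<star> distr M borel (\<lambda>\<omega>. \<Sum>j\<in>I. Y j \<omega>))"
    using Y by (intro sum_indep_random_variable indep_var_sum_vector[OF I indep]) auto
  then show ?thesis using I by simp
qed

lemma (in prob_space) distr_iid_sum: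
  fixes Z :: "nat \<Rightarrow> 'a \<Rightarrow> 'b::ordered_euclidean_space"
  assumes "indep_vars (\<lambda>_. borel) Z {..<n}" and "\<And>i. i < n \<Longrightarrow> distr M borel (Z i) = \<nu>"
  shows "distr M borel (\<lambda>\<omega>. \<Sum>i<n. Z i \<omega>) = convolution_power n \<nu>"
  using assms
proof (induction n)
  case 0
  show ?case by (simp add: distr_const)
next
  case (Suc n)
  have "indep_vars (\<lambda>_. borel) Z {..<n}"
    by (rule indep_vars_subset[OF Suc.prems(1)]) auto
  then have "distr M borel (\<lambda>\<omega>. \<Sum>i<n. Z i \<omega>) = convolution_power n \<nu>"
    using Suc by simp
  then show ?case
    using distr_sum_insert[of "{..<n}" n Z] Suc.prems by (simp add: lessThan_Suc)
qed

lemma has_convolution_root_return_0: "has_convolution_root m (return borel 0)"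
  unfolding has_convolution_root_def
  by (intro exI[of _ "return borel 0"]) (simp add: prob_space_return convolution_power_return_0)

lemma has_convolution_root_convolution:
  assumes "has_convolution_root m \<mu>" "has_convolution_root m \<nu>"
  shows "has_convolution_root m (\<mu> \<star> \<nu>)"
proof -
  obtain \<mu>' \<nu>' where "prob_space \<mu>'" "sets \<mu>' = sets borel" "convolution_power m \<mu>' = \<mu>"
    "prob_space \<nu>'" "sets \<nu>' = sets borel" "convolution_power m \<nu>' = \<nu>"
    using assms unfolding has_convolution_root_def by blast
  then show ?thesis
    unfolding has_convolution_root_def
    by (intro exI[of _ "\<mu>' \<star> \<nu>'"]) (auto simp: convolution_power_convolution intro!: prob_space_convolution)
qed

lemma has_convolution_root_linear:
  fixes f :: "'a::ordered_euclidean_space \<Rightarrow> 'b::ordered_euclidean_space"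
  assumes "has_convolution_root m \<mu>" and f: "linear f"
  shows "has_convolution_root m (distr \<mu> borel f)"
proof -
  obtain \<nu> where \<nu>: "prob_space \<nu>" "sets \<nu> = sets borel" "convolution_power m \<nu> = \<mu>"
    using assms unfolding has_convolution_root_def by blast
  have "f \<in> borel_measurable borel"
    using f by (rule linear_borel_measurable)
  then have "f \<in> borel_measurable \<nu>"
    using \<nu>(2) by (simp cong: measurable_cong_sets)
  then have "prob_space (distr \<nu> borel f)"
    by (rule prob_space.prob_space_distr[OF \<nu>(1)])
  then show ?thesis
    unfolding has_convolution_root_def
    using distr_convolution_power_linear[OF f \<nu>(1,2), of m] \<nu>(3) by (intro exI[of _ "distr \<nu> borel f"]) simp
qed

lemma infinitely_divisible_rv_has_convolution_root:
  assumes "infinitely_divisible_rv M Y" and "1 \<le> m"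
  shows "has_convolution_root m (distr M borel Y)"
proof -
  obtain N :: "(nat \<Rightarrow> real) measure" and Z where N: "prob_space N"
    and Z: "prob_space.indep_vars N (\<lambda>_. borel :: real measure) Z {..<m}"
    and eq: "\<And>i. i < m \<Longrightarrow> distr N borel (Z i) = distr N borel (Z 0)"
    and law: "distr M borel Y = distr N borel (\<lambda>\<omega>. \<Sum>i<m. Z i \<omega>)"
    using assms unfolding infinitely_divisible_rv_def by blast
  interpret prob_space N by fact
  have "Z 0 \<in> borel_measurable N"
    using Z assms(2) unfolding indep_vars_def by auto
  then show ?thesis
    unfolding has_convolution_root_def law
    by (intro exI[of _ "distr N borel (Z 0)"])
      (simp add: prob_space_distr distr_iid_sum[OF Z eq])
qed

text \<open>If \<open>m\<close> independent vectors with law \<open>\<nu>\<close> all lie in the half-space \<open>a \<le> u \<bullet> x\<close>, then their sum lies in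
\<open>m a \<le> u \<bullet> x\<close>. The tail of \<open>\<nu>\<close> in any direction is thus bounded by the \<open>m\<close>-th root of the tail of its
\<open>m\<close>-th power, which is the source of tightness for convolution roots.\<close>

lemma convolution_power_tail:
  fixes \<nu> :: "'a::ordered_euclidean_space measure"
  assumes \<nu>: "prob_space \<nu>" and sets_\<nu> [measurable_cong]: "sets \<nu> = sets borel"
  shows "measure \<nu> {x. a \<le> u \<bullet> x} ^ m \<le> measure (convolution_power m \<nu>) {x. real m * a \<le> u \<bullet> x}"
proof (induction m)
  case 0
  show ?case by (simp add: measure_return)
next
  case (Suc m)
  interpret \<nu>: prob_space \<nu> by fact
  interpret Q: prob_space "convolution_power m \<nu>" by (rule prob_space_convolution_power[OF \<nu> sets_\<nu>])
  interpret pair_prob_space \<nu> "convolution_power m \<nu>" ..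
  let ?A = "{x. a \<le> u \<bullet> x}" and ?B = "{x. real m * a \<le> u \<bullet> x}"
  have sp: "space \<nu> = UNIV" "space (convolution_power m \<nu>) = UNIV"
    using sets_eq_imp_space_eq[OF sets_\<nu>] sets_eq_imp_space_eq[OF sets_convolution_power] by auto
  have AB: "?A \<in> sets \<nu>" "?B \<in> sets (convolution_power m \<nu>)"
    by (simp_all add: sets_\<nu>)
  have meas: "(\<lambda>(x, y). x + y) -` {x. real (Suc m) * a \<le> u \<bullet> x} \<inter>
      space (\<nu> \<Otimes>\<^sub>M convolution_power m \<nu>) \<in> sets (\<nu> \<Otimes>\<^sub>M convolution_power m \<nu>)"
    by (rule measurable_sets[of _ _ borel])
      (measurable, intro borel_closed closed_Collect_le continuous_intros)
  have "measure \<nu> ?A ^ Suc m \<le> measure \<nu> ?A * measure (convolution_power m \<nu>) ?B"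
    using Suc by (simp add: mult_left_mono)
  also have "\<dots> = measure (\<nu> \<Otimes>\<^sub>M convolution_power m \<nu>) (?A \<times> ?B)"
    by (simp add: measure_def Q.emeasure_pair_measure_Times[OF AB] enn2real_mult)
  also have "\<dots> \<le> measure (\<nu> \<Otimes>\<^sub>M convolution_power m \<nu>)
      ((\<lambda>(x, y). x + y) -` {x. real (Suc m) * a \<le> u \<bullet> x} \<inter> space (\<nu> \<Otimes>\<^sub>M convolution_power m \<nu>))"
    by (intro finite_measure_mono meas) (auto simp: inner_add_right algebra_simps space_pair_measure sp)
  also have "\<dots> = measure (convolution_power (Suc m) \<nu>) {x. real (Suc m) * a \<le> u \<bullet> x}"
    by (simp add: convolution_def measure_distr)
  finally show ?case .
qed


section \<open>Almost sure limits and their laws\<close>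

text \<open>The portmanteau inequality for open sets: a limit in an open set forces the sequence to be in it
eventually, so the indicators satisfy \<open>1\<^sub>U(W) \<le> liminf 1\<^sub>U(V\<^sub>k)\<close>, and Fatou's lemma applies.\<close>

lemma (in prob_space) eventually_prob_open_greater:
  fixes V :: "nat \<Rightarrow> 'a \<Rightarrow> 'b::topological_space"
  assumes [measurable]: "\<And>k. V k \<in> borel_measurable M" "W \<in> borel_measurable M"
    and lim: "AE \<omega> in M. (\<lambda>k. V k \<omega>) \<longlonglongrightarrow> W \<omega>"
    and U: "open U" and gt: "a < prob {\<omega> \<in> space M. W \<omega> \<in> U}"
  shows "\<forall>\<^sub>F k in sequentially. a < prob {\<omega> \<in> space M. V k \<omega> \<in> U}"
proof -
  have [measurable]: "U \<in> sets borel" using U by simp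
  have ind: "(\<integral>\<^sup>+\<omega>. indicator U (Y \<omega>) \<partial>M) = ennreal (prob {\<omega> \<in> space M. Y \<omega> \<in> U})"
    if [measurable]: "Y \<in> borel_measurable M" for Y
  proof -
    have "(\<integral>\<^sup>+\<omega>. indicator U (Y \<omega>) \<partial>M) = (\<integral>\<^sup>+\<omega>. indicator {\<omega> \<in> space M. Y \<omega> \<in> U} \<omega> \<partial>M)"
      by (intro nn_integral_cong) (auto simp: indicator_def)
    then show ?thesis by (simp add: emeasure_eq_measure)
  qed
  have "AE \<omega> in M. (indicator U (W \<omega>) :: ennreal) \<le> liminf (\<lambda>k. indicator U (V k \<omega>))"
    using lim
  proof eventually_elim
    case (elim \<omega>)
    show ?case
    proof (cases "W \<omega> \<in> U")
      case True
      then have "\<forall>\<^sub>F k in sequentially. V k \<omega> \<in> U"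
        using topological_tendstoD[OF elim U] by simp
      then have "\<forall>\<^sub>F k in sequentially. (1::ennreal) \<le> indicator U (V k \<omega>)"
        by eventually_elim simp
      then show ?thesis
        using True by (simp add: Liminf_bounded)
    qed simp
  qed
  then have "(\<integral>\<^sup>+\<omega>. indicator U (W \<omega>) \<partial>M) \<le> (\<integral>\<^sup>+\<omega>. liminf (\<lambda>k. indicator U (V k \<omega>)) \<partial>M)"
    by (rule nn_integral_mono_AE)
  also have "\<dots> \<le> liminf (\<lambda>k. \<integral>\<^sup>+\<omega>. indicator U (V k \<omega>) \<partial>M)"
    by (rule nn_integral_liminf) measurable
  finally have le: "ennreal (prob {\<omega> \<in> space M. W \<omega> \<in> U}) \<le>
      liminf (\<lambda>k. ennreal (prob {\<omega> \<in> space M. V k \<omega> \<in> U}))"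
    by (simp add: ind)
  show ?thesis
  proof (cases "a < 0")
    case True
    then show ?thesis by (intro always_eventually) (auto intro: less_le_trans)
  next
    case False
    then have "ennreal a < liminf (\<lambda>k. ennreal (prob {\<omega> \<in> space M. V k \<omega> \<in> U}))"
      using gt le by (intro less_le_trans[OF _ le]) (simp add: ennreal_lessI)
    then have "\<forall>\<^sub>F k in sequentially. ennreal a < ennreal (prob {\<omega> \<in> space M. V k \<omega> \<in> U})"
      by (rule less_LiminfD)
    then show ?thesis
      by eventually_elim (use False in \<open>simp add: ennreal_less_iff\<close>)
  qed
qed

lemma (in prob_space) eventually_prob_closed_less:
  fixes V :: "nat \<Rightarrow> 'a \<Rightarrow> 'b::topological_space"
  assumes V [measurable]: "\<And>k. V k \<in> borel_measurable M" "W \<in> borel_measurable M"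
    and lim: "AE \<omega> in M. (\<lambda>k. V k \<omega>) \<longlonglongrightarrow> W \<omega>"
    and C: "closed C" and less: "prob {\<omega> \<in> space M. W \<omega> \<in> C} < a"
  shows "\<forall>\<^sub>F k in sequentially. prob {\<omega> \<in> space M. V k \<omega> \<in> C} < a"
proof -
  have [measurable]: "C \<in> sets borel" using C by simp
  have compl: "prob {\<omega> \<in> space M. Y \<omega> \<in> - C} = 1 - prob {\<omega> \<in> space M. Y \<omega> \<in> C}"
    if [measurable]: "Y \<in> borel_measurable M" for Y
    using prob_neg[of "\<lambda>\<omega>. Y \<omega> \<in> C"] by simp
  have "\<forall>\<^sub>F k in sequentially. 1 - a < prob {\<omega> \<in> space M. V k \<omega> \<in> - C}"
    using less by (intro eventually_prob_open_greater[OF V lim]) (use C compl[OF V(2)] in auto)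
  then show ?thesis
    by eventually_elim (simp only: compl[OF V(1)])
qed

text \<open>Closed sets generate the Borel sets and are stable under intersection, and the indicator of a
closed set is the pointwise limit of the bounded continuous functions \<open>max(0, 1 - n dist(x, C))\<close>.\<close>

lemma borel_measure_eqI_continuous:
  fixes \<mu> \<nu> :: "'a::metric_space measure"
  assumes "prob_space \<mu>" "prob_space \<nu>"
    and sets [measurable_cong]: "sets \<mu> = sets borel" "sets \<nu> = sets borel"
    and eq: "\<And>g::'a \<Rightarrow> real. continuous_on UNIV g \<Longrightarrow> (\<And>x. \<bar>g x\<bar> \<le> 1) \<Longrightarrow>
      (\<integral>x. g x \<partial>\<mu>) = (\<integral>x. g x \<partial>\<nu>)"
  shows "\<mu> = \<nu>"
proof -
  interpret \<mu>: prob_space \<mu> by fact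
  interpret \<nu>: prob_space \<nu> by fact
  have closed_eq: "emeasure \<mu> C = emeasure \<nu> C" if C: "closed C" for C
  proof (cases "C = {}")
    case False
    define g where "g n x = max 0 (1 - real n * infdist x C)" for n x
    have cont: "continuous_on UNIV (g n)" for n
      unfolding g_def by (intro continuous_intros)
    have bd: "\<bar>g n x\<bar> \<le> 1" for n x
      by (auto simp: g_def infdist_nonneg)
    have lim: "(\<lambda>n. g n x) \<longlonglongrightarrow> indicator C x" for x
    proof (cases "x \<in> C")
      case True
      then show ?thesis by (simp add: g_def)
    next
      case x: False
      then have pos: "0 < infdist x C"
        using C False by (metis in_closed_iff_infdist_zero infdist_nonneg less_eq_real_def)
      obtain n0 :: nat where n0: "1 < real n0 * infdist x C"
        using reals_Archimedean3[OF pos] by blast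
      have "g n x = 0" if "n0 \<le> n" for n
      proof -
        have "real n0 * infdist x C \<le> real n * infdist x C"
          using that pos by (intro mult_right_mono) auto
        then show ?thesis using n0 by (simp add: g_def)
      qed
      then have "\<forall>\<^sub>F n in sequentially. g n x = 0"
        using eventually_sequentially by blast
      then show ?thesis using x by (simp add: tendsto_eventually)
    qed
    have conv: "(\<lambda>n. \<integral>x. g n x \<partial>\<rho>) \<longlonglongrightarrow> measure \<rho> C"
      if "prob_space \<rho>" and [measurable_cong]: "sets \<rho> = sets borel" for \<rho>
    proof -
      interpret \<rho>: prob_space \<rho> by fact
      have [measurable]: "g n \<in> borel_measurable borel" for n
        by (rule borel_measurable_continuous_onI[OF cont])
      have [measurable]: "C \<in> sets \<rho>" using C that by simp
      have "(\<lambda>n. \<integral>x. g n x \<partial>\<rho>) \<longlonglongrightarrow> (\<integral>x. indicator C x \<partial>\<rho>)"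
        by (rule integral_dominated_convergence[where w = "\<lambda>_. 1"]) (use lim bd in auto)
      then show ?thesis by simp
    qed
    have "(\<lambda>n. \<integral>x. g n x \<partial>\<mu>) \<longlonglongrightarrow> measure \<nu> C"
      unfolding eq[OF cont bd] by (rule conv[OF assms(2) sets(2)])
    then have "measure \<mu> C = measure \<nu> C"
      by (rule LIMSEQ_unique[OF conv[OF assms(1) sets(1)]])
    then show ?thesis
      by (simp add: \<mu>.emeasure_eq_measure \<nu>.emeasure_eq_measure)
  qed simp
  have borel_closed: "sets (borel::'a measure) = sigma_sets UNIV (Collect closed)"
    by (simp add: borel_eq_closed)
  show ?thesis
    by (rule measure_eqI_generator_eq[where E = "Collect closed" and A = "\<lambda>_. UNIV" and \<Omega> = UNIV])
      (use closed_eq in \<open>auto simp: Int_stable_def borel_closed sets\<close>)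
qed

text \<open>The two sequences live on different probability spaces, so only laws can be compared: both
expectations of a bounded continuous function are limits of the same numbers.\<close>

lemma AE_limits_same_law:
  fixes V :: "nat \<Rightarrow> 'w \<Rightarrow> 'b::metric_space" and V' :: "nat \<Rightarrow> 'v \<Rightarrow> 'b"
  assumes "prob_space M" "prob_space N"
    and [measurable]: "\<And>k. V k \<in> borel_measurable M" "W \<in> borel_measurable M"
    and [measurable]: "\<And>k. V' k \<in> borel_measurable N" "W' \<in> borel_measurable N"
    and lim: "AE \<omega> in M. (\<lambda>k. V k \<omega>) \<longlonglongrightarrow> W \<omega>"
    and lim': "AE \<omega> in N. (\<lambda>k. V' k \<omega>) \<longlonglongrightarrow> W' \<omega>"
    and law: "\<And>k. distr M borel (V k) = distr N borel (V' k)"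
  shows "distr M borel W = distr N borel W'"
proof (rule borel_measure_eqI_continuous)
  interpret M: prob_space M by fact
  interpret N: prob_space N by fact
  show "prob_space (distr M borel W)" "prob_space (distr N borel W')"
    by (simp_all add: M.prob_space_distr N.prob_space_distr)
  fix g :: "'b \<Rightarrow> real" assume g: "continuous_on UNIV g" "\<And>x. \<bar>g x\<bar> \<le> 1"
  then have [measurable]: "g \<in> borel_measurable borel"
    by (intro borel_measurable_continuous_onI)
  have isc: "isCont g x" for x
    using g(1) by (simp add: continuous_on_eq_continuous_at)
  have "(\<lambda>k. \<integral>\<omega>. g (V k \<omega>) \<partial>M) \<longlonglongrightarrow> (\<integral>\<omega>. g (W \<omega>) \<partial>M)"
    by (rule integral_dominated_convergence[where w = "\<lambda>_. 1"])
      (use lim g(2) in \<open>auto elim!: eventually_mono intro: isCont_tendsto_compose[OF isc]\<close>)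
  moreover have "(\<lambda>k. \<integral>\<omega>. g (V' k \<omega>) \<partial>N) \<longlonglongrightarrow> (\<integral>\<omega>. g (W' \<omega>) \<partial>N)"
    by (rule integral_dominated_convergence[where w = "\<lambda>_. 1"])
      (use lim' g(2) in \<open>auto elim!: eventually_mono intro: isCont_tendsto_compose[OF isc]\<close>)
  moreover have "(\<integral>\<omega>. g (V k \<omega>) \<partial>M) = (\<integral>\<omega>. g (V' k \<omega>) \<partial>N)" for k
    using arg_cong[OF law[of k], of "\<lambda>\<rho>. \<integral>x. g x \<partial>\<rho>"] by (simp add: integral_distr)
  ultimately have "(\<integral>\<omega>. g (W \<omega>) \<partial>M) = (\<integral>\<omega>. g (W' \<omega>) \<partial>N)"
    using LIMSEQ_unique by auto
  then show "(\<integral>x. g x \<partial>distr M borel W) = (\<integral>x. g x \<partial>distr N borel W')"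
    by (simp add: integral_distr)
qed simp_all

section \<open>A space-filling curve with a Borel section\<close>

text \<open>The curve is a variant of Schoenberg's. A sequence of bits is stored as a point of the Cantor set,
with ternary digits \<open>0\<close> and \<open>2\<close>, and a continuous periodic function reads each bit back. The
coordinates of a point of the cube are coded by distributing their binary digits over this sequence.\<close>

definition binary_digit :: "nat \<Rightarrow> real \<Rightarrow> real" where
  "binary_digit j y = \<lfloor>2 ^ Suc j * y\<rfloor> - 2 * \<lfloor>2 ^ j * y\<rfloor>"

lemma binary_digit_cases: "binary_digit j y = 0 \<or> binary_digit j y = 1"
proof -
  define z where "z = 2 ^ j * y"
  have "\<lfloor>2 * z\<rfloor> - 2 * \<lfloor>z\<rfloor> = 0 \<or> \<lfloor>2 * z\<rfloor> - 2 * \<lfloor>z\<rfloor> = 1" by linarith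
  then have "\<lfloor>2 * (2 ^ j * y)\<rfloor> - 2 * \<lfloor>2 ^ j * y\<rfloor> = 0 \<or> \<lfloor>2 * (2 ^ j * y)\<rfloor> - 2 * \<lfloor>2 ^ j * y\<rfloor> = 1"
    by (simp add: z_def)
  then have "real_of_int (\<lfloor>2 * (2 ^ j * y)\<rfloor> - 2 * \<lfloor>2 ^ j * y\<rfloor>) = 0 \<or>
      real_of_int (\<lfloor>2 * (2 ^ j * y)\<rfloor> - 2 * \<lfloor>2 ^ j * y\<rfloor>) = 1" by presburger
  then show ?thesis by (simp add: binary_digit_def mult.assoc)
qed

lemma binary_digit_sums:
  assumes "0 \<le> y" "y < 1"
  shows "(\<lambda>j. binary_digit j y / 2 ^ Suc j) sums y"
proof -
  have part: "(\<Sum>j<n. binary_digit j y / 2 ^ Suc j) = \<lfloor>2 ^ n * y\<rfloor> / 2 ^ n" for n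
  proof (induction n)
    case 0
    then show ?case using assms by (simp add: floor_eq_iff)
  next
    case (Suc n)
    then show ?case by (simp add: binary_digit_def field_simps)
  qed
  have "(\<lambda>n. \<lfloor>2 ^ n * y\<rfloor> / 2 ^ n) \<longlonglongrightarrow> y"
  proof (rule real_tendsto_sandwich[where f = "\<lambda>n. y - (1/2) ^ n" and h = "\<lambda>_. y"])
    show "\<forall>\<^sub>F n in sequentially. y - (1/2) ^ n \<le> \<lfloor>2 ^ n * y\<rfloor> / 2 ^ n"
    proof (intro always_eventually allI)
      fix n
      have "2 ^ n * y - 1 \<le> \<lfloor>2 ^ n * y\<rfloor>" by linarith
      then have "(2 ^ n * y - 1) / 2 ^ n \<le> \<lfloor>2 ^ n * y\<rfloor> / 2 ^ n"
        by (rule divide_right_mono) simp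
      then show "y - (1/2) ^ n \<le> \<lfloor>2 ^ n * y\<rfloor> / 2 ^ n"
        by (simp add: diff_divide_distrib power_one_over)
    qed
    show "\<forall>\<^sub>F n in sequentially. \<lfloor>2 ^ n * y\<rfloor> / 2 ^ n \<le> y"
      by (intro always_eventually allI) (simp add: divide_le_eq mult.commute)
    have "(\<lambda>n. y - (1/2) ^ n) \<longlonglongrightarrow> y - 0"
      by (intro tendsto_intros LIMSEQ_power_zero) auto
    then show "(\<lambda>n. y - (1/2) ^ n) \<longlonglongrightarrow> y" by simp
  qed simp
  then show ?thesis unfolding sums_def part .
qed

text \<open>This function has period \<open>2\<close>, vanishes on \<open>[0, 1/3]\<close> and equals \<open>1\<close> on \<open>[2/3, 1]\<close>. It therefore reads
the bit stored in the first ternary digit of a point of the Cantor set, and is insensitive to adding even integers.\<close>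

definition digit_detector :: "real \<Rightarrow> real" where
  "digit_detector t = max 0 (min 1 (1/2 - cos (pi * t)))"

definition cantor_number :: "(nat \<Rightarrow> real) \<Rightarrow> real" where
  "cantor_number e = (\<Sum>l. 2 * e l / 3 ^ Suc l)"

lemma cantor_summable:
  assumes "\<And>l. e l = 0 \<or> e l = (1::real)"
  shows "summable (\<lambda>l. 2 * e l / 3 ^ Suc l)"
proof (rule summable_comparison_test'[where g = "\<lambda>l. (1/3) ^ l" and N = 0])
  fix l
  show "norm (2 * e l / 3 ^ Suc l) \<le> (1/3) ^ l"
    using assms[of l] by (auto simp: field_simps)
qed (simp add: summable_geometric)

lemma cantor_number_bounds:
  assumes e: "\<And>l. e l = 0 \<or> e l = (1::real)"
  shows "0 \<le> cantor_number e" "cantor_number e \<le> 1"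
proof -
  have nn: "0 \<le> e l" "e l \<le> 1" for l using e[of l] by auto
  show "0 \<le> cantor_number e"
    unfolding cantor_number_def using nn by (intro suminf_nonneg cantor_summable e) auto
  have geo: "(\<lambda>l. 2 / 3 * (1/3::real) ^ l) sums (2 / 3 * (1 / (1 - 1/3)))"
    by (intro sums_mult geometric_sums) auto
  have "cantor_number e \<le> (\<Sum>l. 2 / 3 * (1/3) ^ l)"
    unfolding cantor_number_def
    by (intro suminf_le cantor_summable e sums_summable[OF geo]) (use nn in \<open>auto simp: field_simps\<close>)
  also have "\<dots> = 1" using sums_unique[OF geo] by simp
  finally show "cantor_number e \<le> 1" .
qed

text \<open>Multiplication by \<open>3\<close> shifts the ternary digits.\<close>

lemma cantor_number_shift:
  assumes e: "\<And>l. e l = 0 \<or> e l = (1::real)"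
  shows "3 * cantor_number e = 2 * e 0 + cantor_number (\<lambda>l. e (Suc l))"
proof -
  have "cantor_number e = (\<Sum>l. 2 * e (Suc l) / 3 ^ Suc (Suc l)) + 2 * e 0 / 3 ^ Suc 0"
    unfolding cantor_number_def by (subst suminf_split_head[OF cantor_summable[of e, OF e]]) simp
  also have "(\<Sum>l. 2 * e (Suc l) / 3 ^ Suc (Suc l)) = cantor_number (\<lambda>l. e (Suc l)) / 3"
    unfolding cantor_number_def
    by (subst suminf_divide[symmetric]) (use cantor_summable[of "\<lambda>l. e (Suc l)"] e in \<open>auto simp: field_simps\<close>)
  finally show ?thesis by simp
qed

text \<open>Multiplying by \<open>3\<^sup>k\<close> brings digit \<open>k\<close> to the front; the digits before it contribute an even integer,
because they are all \<open>0\<close> or \<open>2\<close>.\<close>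

lemma digit_detector_cantor:
  assumes "\<And>l. e l = 0 \<or> e l = (1::real)"
  shows "digit_detector (3 ^ k * cantor_number e) = e k"
  using assms
proof (induction k arbitrary: e)
  case 0
  define r where "r = cantor_number (\<lambda>l. e (Suc l))"
  have r: "0 \<le> r" "r \<le> 1"
    unfolding r_def using 0 by (auto intro!: cantor_number_bounds)
  have c: "cantor_number e = (2 * e 0 + r) / 3"
    using cantor_number_shift[of e] 0 by (simp add: r_def)
  show ?case
  proof (cases "e 0 = 0")
    case True
    \<comment> \<open>The detector is applied to a point of \<open>[0, 1/3]\<close>, where the cosine is at least \<open>1/2\<close>.\<close>
    have "cos (pi / 3) \<le> cos (pi * (r / 3))"
      using r by (intro cos_monotone_0_pi_le) (auto simp: field_simps)
    moreover have third: "r / 3 = cantor_number e" using True c by simp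
    ultimately have "1/2 \<le> cos (pi * cantor_number e)"
      by (simp only: third cos_60)
    then show ?thesis using True by (simp add: digit_detector_def)
  next
    case False
    then have e0: "e 0 = 1" using 0 by auto
    \<comment> \<open>Now the point lies in \<open>[2/3, 1]\<close>, where the cosine is at most \<open>-1/2\<close>.\<close>
    have "cos (pi * ((2 + r) / 3)) \<le> cos (2 * pi / 3)"
      using r by (intro cos_monotone_0_pi_le) (auto simp: field_simps)
    moreover have two_thirds: "(2 + r) / 3 = cantor_number e" using e0 c by simp
    moreover have "cos (2 * pi / 3) = - (1/2)"
      using cos_120 by simp
    ultimately have "cos (pi * cantor_number e) \<le> - (1/2)"
      by (simp only: two_thirds)
    then show ?thesis using e0 by (simp add: digit_detector_def)
  qed
next
  case (Suc k)
  define e' where "e' l = e (Suc l)" for l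
  have e': "e' l = 0 \<or> e' l = 1" for l using Suc.prems by (simp add: e'_def)
  have e0: "e 0 = 0 \<or> e 0 = 1" using Suc.prems by blast
  have "3 ^ Suc k * cantor_number e = 3 ^ k * (3 * cantor_number e)" by simp
  also have "3 * cantor_number e = 2 * e 0 + cantor_number e'"
    using cantor_number_shift[of e] Suc.prems by (simp add: e'_def[abs_def])
  finally have "3 ^ Suc k * cantor_number e = 3 ^ k * cantor_number e' + 2 * (3 ^ k * e 0)"
    by (simp add: algebra_simps)
  moreover have "\<exists>i::int. 3 ^ k * e 0 = i"
    using e0 by (metis mult.right_neutral mult_zero_right of_int_0 of_int_numeral of_int_power)
  then obtain i :: int where "3 ^ k * e 0 = i" by blast
  ultimately have "3 ^ Suc k * cantor_number e = 3 ^ k * cantor_number e' + 2 * i"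
    by simp
  then have "cos (pi * (3 ^ Suc k * cantor_number e)) = cos (pi * (3 ^ k * cantor_number e') + 2 * pi * i)"
    by (simp add: algebra_simps)
  also have "\<dots> = cos (pi * (3 ^ k * cantor_number e'))"
    by (simp only: cos_add cos_int_2pin sin_int_2pin mult_1_right mult_zero_right diff_zero)
  finally have "digit_detector (3 ^ Suc k * cantor_number e) = digit_detector (3 ^ k * cantor_number e')"
    by (simp add: digit_detector_def)
  also have "\<dots> = e' k" by (rule Suc.IH[OF e'])
  also have "\<dots> = e (Suc k)" by (rule e'_def)
  finally show ?case .
qed

text \<open>Coordinate \<open>b\<close> of \<open>\<gamma>(t)\<close> is the binary number whose bits are read from \<open>t\<close> at the positions reserved
for \<open>b\<close>; as a uniform limit of continuous functions it is continuous on the whole line. The section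
\<open>c\<close> writes the binary digits of the coordinates to these positions. Floors are measurable, hence so
is \<open>c\<close>, although it is far from continuous. The section has values in the unit interval, so laws
that are moved by \<open>c\<close> are automatically tight.\<close>

lemma space_filling_curve:
  obtains \<gamma> :: "real \<Rightarrow> 'a::euclidean_space" and c :: "'a \<Rightarrow> real"
  where "continuous_on UNIV \<gamma>" and "c \<in> borel_measurable borel"
    and "\<And>x. 0 \<le> c x \<and> c x \<le> 1"
    and "\<And>x. (\<And>b. b \<in> Basis \<Longrightarrow> 0 \<le> x \<bullet> b \<and> x \<bullet> b < 1) \<Longrightarrow> \<gamma> (c x) = x"
proof -
  define pos :: "'a \<Rightarrow> nat \<Rightarrow> nat" where "pos b j = prod_encode (to_nat_on Basis b, j)" for b j
  define coord where "coord b t = (\<Sum>j. digit_detector (3 ^ pos b j * t) / 2 ^ Suc j)" for b t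
  define \<gamma> where "\<gamma> t = (\<Sum>b\<in>Basis. coord b t *\<^sub>R b)" for t
  \<comment> \<open>Positions that are reserved for no coordinate are filled with arbitrary bits.\<close>
  define dig where "dig x l = (case prod_decode l of (i, j) \<Rightarrow>
      binary_digit j (x \<bullet> from_nat_into (Basis :: 'a set) i))" for x :: 'a and l
  have dig: "dig x l = 0 \<or> dig x l = 1" for x l
    unfolding dig_def by (simp add: split_beta binary_digit_cases)
  have dig_pos: "dig x (pos b j) = binary_digit j (x \<bullet> b)" if "b \<in> Basis" for x b j
    using that by (simp add: dig_def pos_def countable_finite from_nat_into_to_nat_on)
  have cont_coord: "continuous_on UNIV (coord b)" for b
  proof (rule uniform_limit_theorem)
    show "uniform_limit UNIV (\<lambda>n t. \<Sum>j<n. digit_detector (3 ^ pos b j * t) / 2 ^ Suc j)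
        (coord b) sequentially"
      unfolding coord_def[abs_def]
    proof (rule Weierstrass_m_test)
      show "norm (digit_detector (3 ^ pos b j * t) / 2 ^ Suc j) \<le> (1/2) ^ j" for j t
      proof -
        have "0 \<le> digit_detector s \<and> digit_detector s \<le> 1" for s
          by (simp add: digit_detector_def)
        then show ?thesis by (simp add: field_simps abs_le_iff) (smt (verit) power_increasing zero_less_power)
      qed
    qed (simp add: summable_geometric)
    show "\<forall>\<^sub>F n in sequentially. continuous_on UNIV
        (\<lambda>t. \<Sum>j<n. digit_detector (3 ^ pos b j * t) / 2 ^ Suc j)"
      unfolding digit_detector_def by (intro always_eventually allI continuous_intros) auto
  qed simp
  show ?thesis
  proof (rule that[of \<gamma> "\<lambda>x. cantor_number (dig x)"])
    show "continuous_on UNIV \<gamma>"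
      unfolding \<gamma>_def[abs_def] by (intro continuous_intros continuous_on_subset[OF cont_coord]) auto
    show "(\<lambda>x. cantor_number (dig x)) \<in> borel_measurable borel"
      unfolding cantor_number_def dig_def split_beta binary_digit_def by measurable
    show "0 \<le> cantor_number (dig x) \<and> cantor_number (dig x) \<le> 1" for x
      using cantor_number_bounds[of "dig x"] dig by blast
    fix x :: 'a assume x: "\<And>b. b \<in> Basis \<Longrightarrow> 0 \<le> x \<bullet> b \<and> x \<bullet> b < 1"
    have "coord b (cantor_number (dig x)) = x \<bullet> b" if b: "b \<in> Basis" for b
    proof -
      have "coord b (cantor_number (dig x)) = (\<Sum>j. binary_digit j (x \<bullet> b) / 2 ^ Suc j)"
        unfolding coord_def by (simp only: digit_detector_cantor[OF dig] dig_pos[OF b])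
      also have "\<dots> = x \<bullet> b"
        using x[OF b] by (intro sums_unique[symmetric] binary_digit_sums) auto
      finally show ?thesis .
    qed
    then show "\<gamma> (cantor_number (dig x)) = x"
      by (simp add: \<gamma>_def euclidean_representation)
  qed
qed


section \<open>Almost surely convergent couplings of tight sequences\<close>

text \<open>The images of the laws under the section \<open>c\<close> of a space-filling curve \<open>\<gamma>\<close> live on a compact
interval. Helly's theorem yields a weakly convergent subsequence of them, and Skorohod's theorem
turns weak convergence into convergence of random variables \<open>Y\<^sub>k\<close>. Since \<open>\<gamma> \<circ> c\<close> is the identity on
the half-open cube, \<open>\<gamma>(Y\<^sub>k)\<close> has the original law; and it converges wherever the limit of the
\<open>Y\<^sub>k\<close> lies, because \<open>\<gamma>\<close> is continuous on the whole line.\<close>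

lemma cube_coupling:
  fixes \<nu> :: "nat \<Rightarrow> 'a::euclidean_space measure"
  assumes \<nu>: "\<And>k. prob_space (\<nu> k)" and sets [measurable_cong]: "\<And>k. sets (\<nu> k) = sets borel"
    and cube: "\<And>k. AE x in \<nu> k. \<forall>b\<in>Basis. 0 \<le> x \<bullet> b \<and> x \<bullet> b < 1"
  obtains r :: "nat \<Rightarrow> nat" and \<Omega> :: "real measure" and V W
  where "strict_mono r" "prob_space \<Omega>" "\<And>k. V k \<in> borel_measurable \<Omega>" "W \<in> borel_measurable \<Omega>"
    and "\<And>k. distr \<Omega> borel (V k) = \<nu> (r k)"
    and "\<And>\<omega>. \<omega> \<in> space \<Omega> \<Longrightarrow> (\<lambda>k. V k \<omega>) \<longlonglongrightarrow> W \<omega>"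
proof -
  obtain \<gamma> :: "real \<Rightarrow> 'a" and c where \<gamma>: "continuous_on UNIV \<gamma>"
    and c [measurable]: "c \<in> borel_measurable borel"
    and c_bounds: "\<And>x. 0 \<le> c x \<and> c x \<le> 1"
    and retract: "\<And>x. (\<And>b. b \<in> Basis \<Longrightarrow> 0 \<le> x \<bullet> b \<and> x \<bullet> b < 1) \<Longrightarrow> \<gamma> (c x) = x"
    using space_filling_curve by blast
  have [measurable]: "\<gamma> \<in> borel_measurable borel"
    using \<gamma> by (rule borel_measurable_continuous_onI)
  define \<mu> where "\<mu> k = distr (\<nu> k) borel c" for k
  have \<mu>: "real_distribution (\<mu> k)" for k
    using prob_space.real_distribution_distr[OF \<nu>, of c k] by (simp add: \<mu>_def)
  \<comment> \<open>The definition of tightness uses half-open intervals, so the interval starts below \<open>0\<close>.\<close>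
  have mass: "measure (\<mu> k) {-1<..1} = 1" for k
  proof -
    interpret prob_space "\<nu> k" by (rule \<nu>)
    have "-1 < c x" for x using c_bounds[of x] by linarith
    then have "c -` {-1<..1} \<inter> space (\<nu> k) = space (\<nu> k)"
      using c_bounds by auto
    then show ?thesis by (simp add: \<mu>_def measure_distr prob_space)
  qed
  have "\<exists>a b. a < b \<and> (\<forall>k. 1 - \<epsilon> < measure (\<mu> k) {a<..b})" if "0 < \<epsilon>" for \<epsilon>
    by (rule exI[of _ "-1"], rule exI[of _ 1]) (use mass that in auto)
  then have "tight \<mu>"
    unfolding tight_def using \<mu> by blast
  then obtain r \<rho> where r: "strict_mono (r :: nat \<Rightarrow> nat)" and \<rho>: "real_distribution \<rho>"
    and weak: "weak_conv_m (\<mu> \<circ> id \<circ> r) \<rho>"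
    using tight_imp_convergent_subsubsequence[of \<mu> id] by (auto simp: strict_mono_id)
  have weak': "weak_conv_m (\<lambda>k. \<mu> (r k)) \<rho>"
    using weak by (simp add: comp_def)
  obtain \<Omega> :: "real measure" and Y Y' where \<Omega>: "prob_space \<Omega>"
    and [measurable]: "\<And>k. Y k \<in> borel_measurable \<Omega>" and Y': "Y' \<in> measurable \<Omega> lborel"
    and law: "\<And>k. distr \<Omega> borel (Y k) = \<mu> (r k)"
    and lim: "\<And>\<omega>. \<omega> \<in> space \<Omega> \<Longrightarrow> (\<lambda>k. Y k \<omega>) \<longlonglongrightarrow> Y' \<omega>"
    using Skorohod[OF \<mu> \<rho> weak'] by metis
  have [measurable]: "Y' \<in> borel_measurable \<Omega>" using Y' by simp
  show ?thesis
  proof (rule that[of r \<Omega> "\<lambda>k \<omega>. \<gamma> (Y k \<omega>)" "\<lambda>\<omega>. \<gamma> (Y' \<omega>)"])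
    show "strict_mono r" "prob_space \<Omega>" by fact+
    show "distr \<Omega> borel (\<lambda>\<omega>. \<gamma> (Y k \<omega>)) = \<nu> (r k)" for k
    proof -
      have "distr \<Omega> borel (\<lambda>\<omega>. \<gamma> (Y k \<omega>)) = distr (distr \<Omega> borel (Y k)) borel \<gamma>"
        by (simp add: distr_distr comp_def)
      also have "\<dots> = distr (\<nu> (r k)) borel (\<lambda>x. \<gamma> (c x))"
        by (simp add: law \<mu>_def distr_distr comp_def)
      also have "\<dots> = distr (\<nu> (r k)) (\<nu> (r k)) (\<lambda>x. x)"
      proof (rule distr_cong_AE)
        show "AE x in \<nu> (r k). \<gamma> (c x) = x"
          using cube[of "r k"] by eventually_elim (rule retract, blast)
      qed (auto simp: sets)
      finally show ?thesis by simp
    qed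
    show "(\<lambda>k. \<gamma> (Y k \<omega>)) \<longlonglongrightarrow> \<gamma> (Y' \<omega>)" if "\<omega> \<in> space \<Omega>" for \<omega>
    proof (rule isCont_tendsto_compose[OF _ lim[OF that]])
      show "isCont \<gamma> (Y' \<omega>)" using \<gamma> by (simp add: continuous_on_eq_continuous_at)
    qed
  qed measurable
qed

text \<open>The coordinatewise arctangent \<open>h\<close>, rescaled, maps the space homeomorphically onto the open unit cube,
where the previous lemma applies. Its limit might lie on the boundary of the cube; tightness excludes
this, because the sequence is close to the boundary only with small probability.\<close>

lemma tight_coupling:
  fixes \<nu> :: "nat \<Rightarrow> 'a::euclidean_space measure"
  assumes \<nu>: "\<And>k. prob_space (\<nu> k)" and sets [measurable_cong]: "\<And>k. sets (\<nu> k) = sets borel"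
    and tight: "\<And>b \<epsilon>. b \<in> Basis \<Longrightarrow> 0 < \<epsilon> \<Longrightarrow>
      \<exists>a. \<forall>\<^sub>F k in sequentially. measure (\<nu> k) {x. a < \<bar>x \<bullet> b\<bar>} \<le> \<epsilon>"
  obtains r :: "nat \<Rightarrow> nat" and \<Omega> :: "real measure" and V W
  where "strict_mono r" "prob_space \<Omega>" "\<And>k. V k \<in> borel_measurable \<Omega>" "W \<in> borel_measurable \<Omega>"
    and "\<And>k. distr \<Omega> borel (V k) = \<nu> (r k)"
    and "AE \<omega> in \<Omega>. (\<lambda>k. V k \<omega>) \<longlonglongrightarrow> W \<omega>"
proof -
  define h :: "'a \<Rightarrow> 'a" where "h x = (\<Sum>b\<in>Basis. (1/2 + arctan (x \<bullet> b) / pi) *\<^sub>R b)" for x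
  define h' :: "'a \<Rightarrow> 'a" where "h' y = (\<Sum>b\<in>Basis. tan (pi * (y \<bullet> b - 1/2)) *\<^sub>R b)" for y
  have h_coord: "h x \<bullet> b = 1/2 + arctan (x \<bullet> b) / pi" if "b \<in> Basis" for x b
    using that by (simp add: h_def inner_sum_left inner_Basis if_distrib cong: if_cong)
  have h_cube: "0 < h x \<bullet> b \<and> h x \<bullet> b < 1" if "b \<in> Basis" for x b
    using arctan_bounded[of "x \<bullet> b"] that by (auto simp: h_coord field_simps)
  have h'_h: "h' (h x) = x" for x
    by (simp add: h'_def h_coord tan_arctan euclidean_representation)
  have h [measurable]: "h \<in> borel_measurable borel"
    unfolding h_def[abs_def] by (intro borel_measurable_continuous_onI continuous_intros) simp
  have [measurable]: "h' \<in> borel_measurable borel"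
    unfolding h'_def[abs_def] tan_def by measurable
  define \<nu>' where "\<nu>' k = distr (\<nu> k) borel h" for k
  have \<nu>': "prob_space (\<nu>' k)" "sets (\<nu>' k) = sets borel" for k
    unfolding \<nu>'_def by (auto intro!: prob_space.prob_space_distr \<nu>)
  have cube: "AE x in \<nu>' k. \<forall>b\<in>Basis. 0 \<le> x \<bullet> b \<and> x \<bullet> b < 1" for k
    unfolding \<nu>'_def using h_cube by (subst AE_distr_iff) (auto simp: less_imp_le)
  obtain r \<Omega> V W where r: "strict_mono r" and \<Omega>: "prob_space (\<Omega> :: real measure)"
    and [measurable]: "\<And>k. V k \<in> borel_measurable \<Omega>" "W \<in> borel_measurable \<Omega>"
    and law: "\<And>k. distr \<Omega> borel (V k) = \<nu>' (r k)"
    and lim: "\<And>\<omega>. \<omega> \<in> space \<Omega> \<Longrightarrow> (\<lambda>k. V k \<omega>) \<longlonglongrightarrow> W \<omega>"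
    by (rule cube_coupling[OF \<nu>' cube]) (rule that)
  interpret \<Omega>: prob_space \<Omega> by fact
  have "AE \<omega> in \<Omega>. \<bar>W \<omega> \<bullet> b - 1/2\<bar> < 1/2" if b: "b \<in> Basis" for b
  proof -
    let ?B = "{\<omega> \<in> space \<Omega>. \<not> \<bar>W \<omega> \<bullet> b - 1/2\<bar> < 1/2}"
    have "\<Omega>.prob ?B \<le> 0 + \<epsilon>" if "0 < \<epsilon>" for \<epsilon>
    proof -
      obtain a where a: "\<forall>\<^sub>F k in sequentially. measure (\<nu> k) {x. a < \<bar>x \<bullet> b\<bar>} \<le> \<epsilon>"
        using tight[OF b \<open>0 < \<epsilon>\<close>] by blast
      \<comment> \<open>In the open cube, \<open>U\<close> is the image under \<open>h\<close> of the tail event of coordinate \<open>b\<close>; it also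
        contains all points whose coordinate \<open>b\<close> is outside the open unit interval.\<close>
      define U where "U = {y :: 'a. arctan a / pi < \<bar>y \<bullet> b - 1/2\<bar>}"
      have U: "open U"
        unfolding U_def by (intro open_Collect_less continuous_intros)
      then have [measurable]: "U \<in> sets borel" by simp
      have "\<forall>\<^sub>F k in sequentially. measure (\<nu> (r k)) {x. a < \<bar>x \<bullet> b\<bar>} \<le> \<epsilon>"
        using a r by (rule eventually_subseq[rotated])
      then have ev: "\<forall>\<^sub>F k in sequentially. \<Omega>.prob {\<omega> \<in> space \<Omega>. V k \<omega> \<in> U} \<le> \<epsilon>"
      proof eventually_elim
        case (elim k)
        interpret N: prob_space "\<nu> (r k)" by (rule \<nu>)
        have sp: "space (\<nu> (r k)) = UNIV" using sets_eq_imp_space_eq[OF sets] by simp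
        have "\<Omega>.prob {\<omega> \<in> space \<Omega>. V k \<omega> \<in> U} = measure (\<nu>' (r k)) U"
          unfolding law[symmetric] by (subst measure_distr) (auto simp: vimage_def Int_def conj_commute)
        also have "\<dots> = measure (\<nu> (r k)) {x. h x \<in> U}"
          unfolding \<nu>'_def by (subst measure_distr) (auto simp: vimage_def sp)
        also have "\<dots> \<le> measure (\<nu> (r k)) {x. a < \<bar>x \<bullet> b\<bar>}"
        proof (rule N.finite_measure_mono)
          show "{x. h x \<in> U} \<subseteq> {x. a < \<bar>x \<bullet> b\<bar>}"
          proof safe
            fix x assume "h x \<in> U"
            then have "arctan a < \<bar>arctan (x \<bullet> b)\<bar>"
              by (simp add: U_def h_coord[OF b] abs_divide divide_strict_right_mono divide_less_cancel)
            also have "\<dots> = arctan \<bar>x \<bullet> b\<bar>"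
              by (simp add: abs_if arctan_minus)
            finally show "a < \<bar>x \<bullet> b\<bar>" by (simp add: arctan_less_iff)
          qed
        qed (simp add: sets)
        finally show ?case using elim by simp
      qed
      have "\<Omega>.prob {\<omega> \<in> space \<Omega>. W \<omega> \<in> U} \<le> \<epsilon>"
      proof (rule ccontr)
        assume "\<not> ?thesis"
        then have "\<forall>\<^sub>F k in sequentially. \<epsilon> < \<Omega>.prob {\<omega> \<in> space \<Omega>. V k \<omega> \<in> U}"
          using lim U by (intro \<Omega>.eventually_prob_open_greater[where W = W]) auto
        with ev have "\<forall>\<^sub>F k in sequentially. False"
          by eventually_elim simp
        then show False by simp
      qed
      moreover have "\<Omega>.prob ?B \<le> \<Omega>.prob {\<omega> \<in> space \<Omega>. W \<omega> \<in> U}"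
      proof (rule \<Omega>.finite_measure_mono)
        have "arctan a / pi < 1/2" using arctan_ubound[of a] by (simp add: field_simps)
        then have "arctan a / pi < s" if "\<not> s < 1/2" for s using that by linarith
        then show "?B \<subseteq> {\<omega> \<in> space \<Omega>. W \<omega> \<in> U}" unfolding U_def by blast
      qed measurable
      ultimately show ?thesis by simp
    qed
    then have "\<Omega>.prob ?B \<le> 0" by (rule field_le_epsilon)
    then have "\<Omega>.prob ?B = 0" using measure_nonneg[of \<Omega> ?B] by linarith
    then show ?thesis
      by (subst AE_iff_measurable[OF _ refl]) (auto simp: \<Omega>.emeasure_eq_measure)
  qed
  then have inside: "AE \<omega> in \<Omega>. \<forall>b\<in>Basis. \<bar>W \<omega> \<bullet> b - 1/2\<bar> < 1/2"
    by (intro AE_finite_allI) auto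
  show ?thesis
  proof (rule that[of r \<Omega> "\<lambda>k \<omega>. h' (V k \<omega>)" "\<lambda>\<omega>. h' (W \<omega>)"])
    show "strict_mono r" "prob_space \<Omega>" by fact+
    show "distr \<Omega> borel (\<lambda>\<omega>. h' (V k \<omega>)) = \<nu> (r k)" for k
    proof -
      have "distr \<Omega> borel (\<lambda>\<omega>. h' (V k \<omega>)) = distr (distr \<Omega> borel (V k)) borel h'"
        by (simp add: distr_distr comp_def)
      also have "\<dots> = distr (\<nu> (r k)) borel (\<lambda>x. x)"
        by (simp add: law \<nu>'_def distr_distr comp_def h'_h)
      also have "\<dots> = distr (\<nu> (r k)) (\<nu> (r k)) (\<lambda>x. x)"
        by (rule distr_cong) (auto simp: sets)
      finally show ?thesis by simp
    qed
    show "AE \<omega> in \<Omega>. (\<lambda>k. h' (V k \<omega>)) \<longlonglongrightarrow> h' (W \<omega>)"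
      using inside
    proof (rule AE_mp, intro AE_I2 impI)
      fix \<omega> assume \<omega>: "\<omega> \<in> space \<Omega>" and in_cube: "\<forall>b\<in>Basis. \<bar>W \<omega> \<bullet> b - 1/2\<bar> < 1/2"
      have "(\<lambda>k. tan (pi * (V k \<omega> \<bullet> b - 1/2))) \<longlonglongrightarrow> tan (pi * (W \<omega> \<bullet> b - 1/2))" if "b \<in> Basis" for b
      proof (rule isCont_tendsto_compose[where g = tan])
        show "(\<lambda>k. pi * (V k \<omega> \<bullet> b - 1/2)) \<longlonglongrightarrow> pi * (W \<omega> \<bullet> b - 1/2)"
          by (intro tendsto_intros lim[OF \<omega>])
        have "\<bar>W \<omega> \<bullet> b - 1/2\<bar> < 1/2" using in_cube that by blast
        then have "- (1/2) < W \<omega> \<bullet> b - 1/2" "W \<omega> \<bullet> b - 1/2 < 1/2" by linarith+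
        then have "pi * - (1/2) < pi * (W \<omega> \<bullet> b - 1/2)" "pi * (W \<omega> \<bullet> b - 1/2) < pi * (1/2)"
          by (simp_all only: mult_less_cancel_left_pos[OF pi_gt_zero])
        then have "0 < cos (pi * (W \<omega> \<bullet> b - 1/2))" by (intro cos_gt_zero_pi) auto
        then show "isCont tan (pi * (W \<omega> \<bullet> b - 1/2))" by (intro isCont_tan) simp
      qed
      then show "(\<lambda>k. h' (V k \<omega>)) \<longlonglongrightarrow> h' (W \<omega>)"
        unfolding h'_def by (intro tendsto_intros) auto
    qed
  qed measurable
qed

lemma (in prob_space) tail_below:
  fixes Y :: "'a \<Rightarrow> real"
  assumes [measurable]: "Y \<in> borel_measurable M" and "0 < \<epsilon>"
  obtains c where "prob {\<omega> \<in> space M. c \<le> Y \<omega>} < \<epsilon>"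
proof -
  have "(\<lambda>n. prob {\<omega> \<in> space M. real n \<le> Y \<omega>}) \<longlonglongrightarrow> prob (\<Inter>n. {\<omega> \<in> space M. real n \<le> Y \<omega>})"
    by (rule finite_Lim_measure_decseq) (auto simp: decseq_def)
  moreover have "(\<Inter>n. {\<omega> \<in> space M. real n \<le> Y \<omega>}) = {}"
  proof -
    have "\<exists>n. \<not> real n \<le> Y \<omega>" for \<omega>
      using reals_Archimedean2[of "Y \<omega>"] by (auto simp: not_le)
    then show ?thesis by auto
  qed
  ultimately have "(\<lambda>n. prob {\<omega> \<in> space M. real n \<le> Y \<omega>}) \<longlonglongrightarrow> 0" by simp
  then have "\<forall>\<^sub>F n in sequentially. prob {\<omega> \<in> space M. real n \<le> Y \<omega>} < \<epsilon>"
    using \<open>0 < \<epsilon>\<close> by (rule order_tendstoD)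
  then show ?thesis using that by (auto simp: eventually_sequentially)
qed

section \<open>Convolution roots of almost sure limits\<close>

lemma (in prob_space) eventually_root_tail:
  fixes V :: "nat \<Rightarrow> 'a \<Rightarrow> 'b::ordered_euclidean_space"
  assumes V [measurable]: "\<And>k. V k \<in> borel_measurable M" "W \<in> borel_measurable M"
    and lim: "AE \<omega> in M. (\<lambda>k. V k \<omega>) \<longlonglongrightarrow> W \<omega>"
    and \<nu>: "\<And>k. prob_space (\<nu> k)" "\<And>k. sets (\<nu> k) = sets borel"
    and power: "\<And>k. convolution_power m (\<nu> k) = distr M borel (V k)"
    and m: "1 \<le> m" and \<epsilon>: "0 < \<epsilon>"
  obtains a where "\<forall>\<^sub>F k in sequentially. measure (\<nu> k) {x. a \<le> u \<bullet> x} < \<epsilon>"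
proof -
  obtain c where c: "prob {\<omega> \<in> space M. c \<le> u \<bullet> W \<omega>} < \<epsilon> ^ m"
    by (rule tail_below[of "\<lambda>\<omega>. u \<bullet> W \<omega>" "\<epsilon> ^ m"]) (use \<epsilon> in auto)
  have "\<forall>\<^sub>F k in sequentially. prob {\<omega> \<in> space M. V k \<omega> \<in> {x. c \<le> u \<bullet> x}} < \<epsilon> ^ m"
    by (rule eventually_prob_closed_less[OF V lim])
      (use c in \<open>auto intro!: closed_Collect_le continuous_intros\<close>)
  then have "\<forall>\<^sub>F k in sequentially. measure (\<nu> k) {x. c / real m \<le> u \<bullet> x} < \<epsilon>"
  proof eventually_elim
    case (elim k)
    have "measure (\<nu> k) {x. c / real m \<le> u \<bullet> x} ^ m \<le>
        measure (distr M borel (V k)) {x. real m * (c / real m) \<le> u \<bullet> x}"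
      unfolding power[symmetric] by (rule convolution_power_tail[OF \<nu>])
    also have "\<dots> = prob {\<omega> \<in> space M. V k \<omega> \<in> {x. c \<le> u \<bullet> x}}"
      using m by (subst measure_distr) (auto simp: vimage_def Int_def conj_commute)
    also have "\<dots> < \<epsilon> ^ m" by (rule elim)
    finally show ?case
      by (rule power_less_imp_less_base) (use \<epsilon> in simp)
  qed
  then show ?thesis by (rule that)
qed

text \<open>The chosen roots are tight, since both tails of every coordinate are controlled by the convergent
sequence. A coupling \<open>Y\<^sub>k \<rightarrow> Y'\<close> of a subsequence of them on a space \<open>\<Omega>\<close> gives, on the \<open>m\<close>-fold product of
\<open>\<Omega>\<close>, convergent sums of \<open>m\<close> independent copies whose laws are those of the \<open>V\<^sub>k\<close>. Thus \<open>W\<close> has the law of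
the sum of \<open>m\<close> independent copies of \<open>Y'\<close>, and the law of \<open>Y'\<close> is the required root.\<close>

theorem (in prob_space) has_convolution_root_AE_limit:
  fixes V :: "nat \<Rightarrow> 'a \<Rightarrow> 'b::ordered_euclidean_space"
  assumes V [measurable]: "\<And>k. V k \<in> borel_measurable M" "W \<in> borel_measurable M"
    and lim: "AE \<omega> in M. (\<lambda>k. V k \<omega>) \<longlonglongrightarrow> W \<omega>"
    and root: "\<And>k. has_convolution_root m (distr M borel (V k))" and m: "1 \<le> m"
  shows "has_convolution_root m (distr M borel W)"
proof -
  obtain \<nu> where \<nu>: "\<And>k. prob_space (\<nu> k)" and sets: "\<And>k. sets (\<nu> k) = sets borel"
    and power: "\<And>k. convolution_power m (\<nu> k) = distr M borel (V k)"
    using root unfolding has_convolution_root_def by metis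
  have tight: "\<exists>a. \<forall>\<^sub>F k in sequentially. measure (\<nu> k) {x. a < \<bar>x \<bullet> b\<bar>} \<le> \<epsilon>" if \<epsilon>: "0 < \<epsilon>" for b \<epsilon>
  proof -
    have half: "0 < \<epsilon> / 2" using \<epsilon> by simp
    \<comment> \<open>The two tails of coordinate \<open>b\<close> are the tails in the directions \<open>b\<close> and \<open>-b\<close>.\<close>
    obtain a1 where a1: "\<forall>\<^sub>F k in sequentially. measure (\<nu> k) {x. a1 \<le> b \<bullet> x} < \<epsilon> / 2"
      by (rule eventually_root_tail[OF V lim \<nu> sets power m half]) (rule that)
    obtain a2 where a2: "\<forall>\<^sub>F k in sequentially. measure (\<nu> k) {x. a2 \<le> (- b) \<bullet> x} < \<epsilon> / 2"
      by (rule eventually_root_tail[OF V lim \<nu> sets power m half]) (rule that)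
    from a1 a2 have "\<forall>\<^sub>F k in sequentially. measure (\<nu> k) {x. max a1 a2 < \<bar>x \<bullet> b\<bar>} \<le> \<epsilon>"
    proof eventually_elim
      case (elim k)
      interpret N: prob_space "\<nu> k" by (rule \<nu>)
      have "measure (\<nu> k) {x. max a1 a2 < \<bar>x \<bullet> b\<bar>} \<le>
          measure (\<nu> k) ({x. a1 \<le> b \<bullet> x} \<union> {x. a2 \<le> (- b) \<bullet> x})"
        by (rule N.finite_measure_mono) (auto simp: sets inner_commute)
      also have "\<dots> \<le> measure (\<nu> k) {x. a1 \<le> b \<bullet> x} + measure (\<nu> k) {x. a2 \<le> (- b) \<bullet> x}"
        by (rule measure_Un_le) (auto simp: sets)
      finally show ?case using elim by simp
    qed
    then show ?thesis by blast
  qed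
  obtain r \<Omega> Y Y' where r: "strict_mono r" and \<Omega>: "prob_space (\<Omega> :: real measure)"
    and [measurable]: "\<And>k. Y k \<in> borel_measurable \<Omega>" "Y' \<in> borel_measurable \<Omega>"
    and law: "\<And>k. distr \<Omega> borel (Y k) = \<nu> (r k)"
    and Y_lim: "AE \<omega> in \<Omega>. (\<lambda>k. Y k \<omega>) \<longlonglongrightarrow> Y' \<omega>"
    by (rule tight_coupling[OF \<nu> sets tight]) (simp, rule that)
  interpret \<Omega>: prob_space \<Omega> by fact
  let ?P = "\<Pi>\<^sub>M j\<in>{..<m}. \<Omega>"
  interpret P: prob_space ?P
    by (intro prob_space_PiM \<Omega>)
  have coord_law: "distr ?P \<Omega> (\<lambda>\<omega>. \<omega> j) = \<Omega>" if "j < m" for j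
    using that by (intro distr_PiM_component) (auto simp: \<Omega>)
  have coord_indep: "P.indep_vars (\<lambda>_. \<Omega>) (\<lambda>j \<omega>. \<omega> j) {..<m}"
  proof (subst P.indep_vars_iff_distr_eq_PiM')
    have "distr ?P ?P (\<lambda>\<omega>. \<lambda>j\<in>{..<m}. \<omega> j) = distr ?P ?P (\<lambda>\<omega>. \<omega>)"
      by (rule distr_cong) (auto simp: space_PiM)
    also have "\<dots> = (\<Pi>\<^sub>M j\<in>{..<m}. distr ?P \<Omega> (\<lambda>\<omega>. \<omega> j))"
      using coord_law by (auto intro!: PiM_cong)
    finally show "distr ?P ?P (\<lambda>\<omega>. \<lambda>j\<in>{..<m}. \<omega> j) = (\<Pi>\<^sub>M j\<in>{..<m}. distr ?P \<Omega> (\<lambda>\<omega>. \<omega> j))" .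
  qed (use m in \<open>auto simp: lessThan_empty_iff\<close>)
  have coord: "distr ?P borel (\<lambda>\<omega>. Z (\<omega> j)) = distr \<Omega> borel Z"
    if [measurable]: "Z \<in> borel_measurable \<Omega>" and j: "j < m" for Z :: "real \<Rightarrow> 'b" and j
  proof -
    have "distr ?P borel (\<lambda>\<omega>. Z (\<omega> j)) = distr (distr ?P \<Omega> (\<lambda>\<omega>. \<omega> j)) borel Z"
      using j by (subst distr_distr) (auto simp: comp_def)
    also have "distr ?P \<Omega> (\<lambda>\<omega>. \<omega> j) = \<Omega>" using j by (rule coord_law)
    finally show ?thesis .
  qed
  have sum_law: "distr ?P borel (\<lambda>\<omega>. \<Sum>j<m. Z (\<omega> j)) = convolution_power m (distr \<Omega> borel Z)"
    if [measurable]: "Z \<in> borel_measurable \<Omega>" for Z :: "real \<Rightarrow> 'b"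
  proof (rule P.distr_iid_sum)
    have "P.indep_vars (\<lambda>_. borel) (\<lambda>j \<omega>. Z (\<omega> j)) {..<m}"
      by (rule P.indep_vars_compose2[OF coord_indep]) simp
    then show "P.indep_vars (\<lambda>_. borel) (\<lambda>j \<omega>. Z (\<omega> j)) {..<m}" .
  qed (simp add: coord)
  have "AE \<omega> in ?P. \<forall>j\<in>{..<m}. (\<lambda>k. Y k (\<omega> j)) \<longlonglongrightarrow> Y' (\<omega> j)"
    by (intro AE_finite_allI AE_PiM_component[where P = "\<lambda>x. (\<lambda>k. Y k x) \<longlonglongrightarrow> Y' x"] \<Omega> Y_lim) auto
  then have sum_lim: "AE \<omega> in ?P. (\<lambda>k. \<Sum>j<m. Y k (\<omega> j)) \<longlonglongrightarrow> (\<Sum>j<m. Y' (\<omega> j))"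
    by eventually_elim (auto intro!: tendsto_sum)
  have sub_lim: "AE \<omega> in M. (\<lambda>k. V (r k) \<omega>) \<longlonglongrightarrow> W \<omega>"
    using lim by eventually_elim (use LIMSEQ_subseq_LIMSEQ[OF _ r] in \<open>auto simp: comp_def\<close>)
  have "distr M borel W = distr ?P borel (\<lambda>\<omega>. \<Sum>j<m. Y' (\<omega> j))"
    by (rule AE_limits_same_law[OF prob_space_axioms P.prob_space_axioms _ _ _ _ sub_lim sum_lim])
      (auto simp: sum_law law power)
  also have "\<dots> = convolution_power m (distr \<Omega> borel Y')"
    by (rule sum_law) measurable
  finally show ?thesis
    unfolding has_convolution_root_def
    by (intro exI[of _ "distr \<Omega> borel Y'"]) (simp add: \<Omega>.prob_space_distr)
qed


section \<open>Integrals of simple functions\<close>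

lemma bounded_borel_empty [simp]: "{} \<in> bounded_borel"
  by (simp add: bounded_borel_def)

lemma infinitely_divisible_random_measureD:
  assumes "infinitely_divisible_random_measure M \<Lambda>"
  shows "prob_space M"
    and "\<And>A. A \<in> bounded_borel \<Longrightarrow> \<Lambda> A \<in> borel_measurable M"
    and "\<And>A :: nat \<Rightarrow> 'a::euclidean_space set. range A \<subseteq> bounded_borel \<Longrightarrow> disjoint_family A \<Longrightarrow>
      prob_space.indep_vars M (\<lambda>_. borel) (\<lambda>n. \<Lambda> (A n)) UNIV"
    and "\<And>A :: nat \<Rightarrow> 'a::euclidean_space set. range A \<subseteq> bounded_borel \<Longrightarrow> disjoint_family A \<Longrightarrow>
      (\<Union>n. A n) \<in> bounded_borel \<Longrightarrow> AE \<omega> in M. (\<lambda>n. \<Lambda> (A n) \<omega>) sums \<Lambda> (\<Union>n. A n) \<omega>"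
    and "\<And>A. A \<in> bounded_borel \<Longrightarrow> infinitely_divisible_rv M (\<Lambda> A)"
  using assms unfolding infinitely_divisible_random_measure_def by simp_all

text \<open>A convergent series with constant terms has terms \<open>0\<close>; this applies to the empty set written as a
countable union of empty sets.\<close>

lemma random_measure_empty:
  assumes "infinitely_divisible_random_measure M \<Lambda>"
  shows "AE \<omega> in M. \<Lambda> {} \<omega> = 0"
proof -
  have "AE \<omega> in M. (\<lambda>n::nat. \<Lambda> {} \<omega>) sums \<Lambda> {} \<omega>"
    using infinitely_divisible_random_measureD(4)[OF assms, of "\<lambda>_. {}"]
    by (auto simp: disjoint_family_on_def)
  then show ?thesis
  proof eventually_elim
    case (elim \<omega>)
    have "(\<lambda>n::nat. \<Lambda> {} \<omega>) \<longlonglongrightarrow> 0"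
      using elim by (intro summable_LIMSEQ_zero sums_summable)
    then show ?case by (simp add: LIMSEQ_const_iff)
  qed
qed

lemma random_measure_disjoint_UN:
  assumes \<Lambda>: "infinitely_divisible_random_measure M \<Lambda>"
    and B: "range B \<subseteq> bounded_borel" "disjoint_family B" and K: "finite (K :: nat set)"
  shows "AE \<omega> in M. \<Lambda> (\<Union>k\<in>K. B k) \<omega> = (\<Sum>k\<in>K. \<Lambda> (B k) \<omega>)"
proof -
  define A where "A k = (if k \<in> K then B k else {})" for k
  have A: "range A \<subseteq> bounded_borel" "disjoint_family A"
    using B by (auto simp: A_def disjoint_family_on_def)
  have union: "(\<Union>k. A k) = (\<Union>k\<in>K. B k)" by (auto simp: A_def split: if_splits)
  have "(\<Union>k\<in>K. B k) \<in> bounded_borel"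
    using B(1) K by (auto simp: bounded_borel_def)
  then have "AE \<omega> in M. (\<lambda>n. \<Lambda> (A n) \<omega>) sums \<Lambda> (\<Union>k\<in>K. B k) \<omega>"
    using infinitely_divisible_random_measureD(4)[OF \<Lambda> A] by (simp add: union)
  then show ?thesis
    using random_measure_empty[OF \<Lambda>]
  proof eventually_elim
    case (elim \<omega>)
    have "(\<lambda>n. \<Lambda> (A n) \<omega>) sums (\<Sum>k\<in>K. \<Lambda> (A k) \<omega>)"
      using K by (rule sums_finite) (simp add: A_def elim(2))
    then have "\<Lambda> (\<Union>k\<in>K. B k) \<omega> = (\<Sum>k\<in>K. \<Lambda> (A k) \<omega>)"
      using elim(1) sums_unique2 by blast
    then show ?case by (simp add: A_def)
  qed
qed

text \<open>The disjoint sets are the atoms of the algebra generated by \<open>\<A>\<close>: points are grouped according to the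
set of members of \<open>\<A>\<close> that contain them. The atom outside \<open>\<Union>\<A>\<close> is left out, as it is
unbounded. The atoms are numbered and padded with empty sets, to match the sequences of sets in the
definition of a random measure.\<close>

lemma disjoint_refinement:
  fixes \<A> :: "'a::euclidean_space set set"
  assumes "finite \<A>" and \<A>: "\<A> \<subseteq> bounded_borel"
  obtains B :: "nat \<Rightarrow> 'a set" and K :: "'a set \<Rightarrow> nat set" and N
  where "range B \<subseteq> bounded_borel" "disjoint_family B"
    and "\<forall>A\<in>\<A>. K A \<subseteq> {..<N} \<and> A = (\<Union>k\<in>K A. B k)"
proof -
  define \<T> where "\<T> = Pow \<A> - {{}}"
  have fin: "finite \<T>" using assms(1) by (simp add: \<T>_def)
  obtain g where g: "bij_betw g {0..<card \<T>} \<T>"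
    using ex_bij_betw_nat_finite[OF fin] by blast
  define N where "N = card \<T>"
  define B where "B k = (if k < N then {x. {A \<in> \<A>. x \<in> A} = g k} else {})" for k
  define K where "K A = {k \<in> {..<N}. A \<in> g k}" for A
  have g_in: "g k \<in> \<T>" if "k < N" for k
    using g that unfolding N_def by (auto dest: bij_betwE)
  have g_inj: "k = l" if "g k = g l" "k < N" "l < N" for k l
    using g that unfolding N_def bij_betw_def inj_on_def by auto
  have "B k \<in> bounded_borel" for k
  proof (cases "k < N")
    case True
    obtain A0 where A0: "A0 \<in> g k" "g k \<subseteq> \<A>"
      using g_in[OF True] by (auto simp: \<T>_def)
    have "B k = {x. \<forall>A\<in>\<A>. x \<in> A \<longleftrightarrow> A \<in> g k}"
      using True A0 by (auto simp: B_def)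
    also have "\<dots> = (\<Inter>A\<in>\<A>. if A \<in> g k then A else - A)"
      by (auto split: if_splits)
    also have "\<dots> \<in> sets borel"
    proof (rule sets.finite_INT)
      show "(if A \<in> g k then A else - A) \<in> sets borel" if "A \<in> \<A>" for A
        using that \<A> by (auto simp: bounded_borel_def)
    qed (use assms(1) A0 in auto)
    finally have "B k \<in> sets borel" .
    moreover have "B k \<subseteq> A0" using True A0 by (auto simp: B_def)
    moreover have "bounded A0" using A0 \<A> by (auto simp: bounded_borel_def)
    ultimately show ?thesis by (auto simp: bounded_borel_def intro: bounded_subset)
  qed (simp add: B_def)
  moreover have "disjoint_family B"
    unfolding disjoint_family_on_def B_def using g_inj by auto
  moreover have "K A \<subseteq> {..<N} \<and> A = (\<Union>k\<in>K A. B k)" if A: "A \<in> \<A>" for A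
  proof (intro conjI equalityI subsetI)
    fix x assume "x \<in> A"
    then have "{A' \<in> \<A>. x \<in> A'} \<in> \<T>" using A by (auto simp: \<T>_def)
    then have "{A' \<in> \<A>. x \<in> A'} \<in> g ` {0..<N}"
      using g by (simp add: N_def bij_betw_def)
    then obtain k where "k < N" "g k = {A' \<in> \<A>. x \<in> A'}" by fastforce
    then show "x \<in> (\<Union>k\<in>K A. B k)" using A \<open>x \<in> A\<close> by (auto simp: K_def B_def)
  qed (auto simp: K_def B_def split: if_splits)
  ultimately show ?thesis using that[of B K N] by blast
qed

text \<open>The summands are independent because \<open>\<Lambda>\<close> is independently scattered, and each is a linear image of
a random variable \<open>\<Lambda>(B\<^sub>k)\<close>, which is infinitely divisible.\<close>

lemma has_convolution_root_disjoint_combination: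
  fixes v :: "nat \<Rightarrow> 'b::ordered_euclidean_space"
  assumes \<Lambda>: "infinitely_divisible_random_measure M \<Lambda>"
    and B: "range B \<subseteq> bounded_borel" "disjoint_family B" and m: "1 \<le> m"
  shows "has_convolution_root m (distr M borel (\<lambda>\<omega>. \<Sum>k<N. \<Lambda> (B k) \<omega> *\<^sub>R v k))"
proof -
  interpret prob_space M by (rule infinitely_divisible_random_measureD(1)[OF \<Lambda>])
  have [measurable]: "\<Lambda> (B k) \<in> borel_measurable M" for k
    using B(1) by (intro infinitely_divisible_random_measureD(2)[OF \<Lambda>]) auto
  have indep: "indep_vars (\<lambda>_. borel) (\<lambda>k \<omega>. \<Lambda> (B k) \<omega> *\<^sub>R v k) UNIV"
    by (rule indep_vars_compose2[OF infinitely_divisible_random_measureD(3)[OF \<Lambda> B]]) simp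
  have one: "has_convolution_root m (distr M borel (\<lambda>\<omega>. \<Lambda> (B k) \<omega> *\<^sub>R v k))" for k
  proof -
    have "has_convolution_root m (distr M borel (\<Lambda> (B k)))"
      using B(1) m
      by (intro infinitely_divisible_rv_has_convolution_root infinitely_divisible_random_measureD(5)[OF \<Lambda>]) auto
    then have "has_convolution_root m (distr (distr M borel (\<Lambda> (B k))) borel (\<lambda>s. s *\<^sub>R v k))"
      by (rule has_convolution_root_linear) (rule linear_scale_left)
    then show ?thesis by (simp add: distr_distr comp_def)
  qed
  show ?thesis
  proof (induction N)
    case 0
    show ?case by (simp add: distr_const has_convolution_root_return_0)
  next
    case (Suc N)
    have "distr M borel (\<lambda>\<omega>. \<Sum>k\<in>insert N {..<N}. \<Lambda> (B k) \<omega> *\<^sub>R v k) =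
        (distr M borel (\<lambda>\<omega>. \<Lambda> (B N) \<omega> *\<^sub>R v N) \<star> distr M borel (\<lambda>\<omega>. \<Sum>k<N. \<Lambda> (B k) \<omega> *\<^sub>R v k))"
      by (rule distr_sum_insert) (auto intro: indep_vars_subset[OF indep])
    then show ?case
      using has_convolution_root_convolution[OF one Suc] by (simp add: lessThan_Suc)
  qed
qed

lemma borel_measurable_vec_lambda:
  fixes f :: "'a \<Rightarrow> 'n::finite \<Rightarrow> real"
  assumes [measurable]: "\<And>i. (\<lambda>x. f x i) \<in> borel_measurable M"
  shows "(\<lambda>x. \<chi> i. f x i) \<in> borel_measurable M"
proof (rule borel_measurable_euclidean_space[THEN iffD2], rule ballI)
  fix b :: "real ^ 'n" assume "b \<in> Basis"
  then obtain i where "b = axis i 1" by (auto simp: Basis_vec_def)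
  then show "(\<lambda>x. (\<chi> i. f x i) \<bullet> b) \<in> borel_measurable M"
    by (simp add: inner_axis)
qed

lemma simple_random_integral_measurable:
  assumes "infinitely_divisible_random_measure M \<Lambda>" and "is_simple s"
  shows "simple_random_integral \<Lambda> UNIV s \<in> borel_measurable M"
  unfolding simple_random_integral_def[abs_def]
  using assms infinitely_divisible_random_measureD(2)[OF assms(1)]
  by (auto simp: is_simple_def intro!: borel_measurable_sum borel_measurable_times)

text \<open>The sets of different coordinates may overlap, which makes the coordinates dependent. A common
refinement to disjoint sets collects the dependence in the coefficient vectors \<open>v\<^sub>k\<close>.\<close>

lemma has_convolution_root_simple_random_integrals:
  fixes s :: "'n::finite \<Rightarrow> 'a::euclidean_space simple"
  assumes \<Lambda>: "infinitely_divisible_random_measure M \<Lambda>"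
    and s: "\<And>i. is_simple (s i)" and m: "1 \<le> m"
  shows "has_convolution_root m
    (distr M borel (\<lambda>\<omega>. (\<chi> i. simple_random_integral \<Lambda> UNIV (s i) \<omega>) :: real ^ 'n))"
proof -
  define \<A> where "\<A> = (\<Union>i. snd ` set (s i))"
  have "finite \<A>" by (simp add: \<A>_def)
  moreover have "\<A> \<subseteq> bounded_borel"
    using s by (force simp: \<A>_def is_simple_def in_set_conv_nth)
  ultimately obtain B :: "nat \<Rightarrow> 'a set" and K N where B: "range B \<subseteq> bounded_borel" "disjoint_family B"
    and K: "\<forall>A\<in>\<A>. K A \<subseteq> {..<N} \<and> A = (\<Union>k\<in>K A. B k)"
    by (rule disjoint_refinement) (rule that)
  have atom: "snd (s i ! j) \<in> \<A>" if "j < length (s i)" for i j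
    unfolding \<A>_def using nth_mem[OF that] by blast
  have [measurable]: "\<Lambda> (B k) \<in> borel_measurable M" for k
    using B(1) by (intro infinitely_divisible_random_measureD(2)[OF \<Lambda>]) auto
  have [measurable]: "simple_random_integral \<Lambda> UNIV (s i) \<in> borel_measurable M" for i
    by (rule simple_random_integral_measurable[OF \<Lambda> s])
  define v :: "nat \<Rightarrow> real ^ 'n"
    where "v k = (\<chi> i. \<Sum>j<length (s i). fst (s i ! j) * (if k \<in> K (snd (s i ! j)) then 1 else 0))" for k
  have "AE \<omega> in M. \<forall>A\<in>\<A>. \<Lambda> A \<omega> = (\<Sum>k\<in>K A. \<Lambda> (B k) \<omega>)"
  proof (rule AE_finite_allI[OF \<open>finite \<A>\<close>])
    fix A assume "A \<in> \<A>"
    with K have KA: "K A \<subseteq> {..<N}" "A = (\<Union>k\<in>K A. B k)" by blast+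
    have "AE \<omega> in M. \<Lambda> (\<Union>k\<in>K A. B k) \<omega> = (\<Sum>k\<in>K A. \<Lambda> (B k) \<omega>)"
      by (rule random_measure_disjoint_UN[OF \<Lambda> B finite_subset[OF KA(1)]]) simp
    then show "AE \<omega> in M. \<Lambda> A \<omega> = (\<Sum>k\<in>K A. \<Lambda> (B k) \<omega>)"
      by (simp only: KA(2)[symmetric])
  qed
  then have eq: "AE \<omega> in M. (\<chi> i. simple_random_integral \<Lambda> UNIV (s i) \<omega>) = (\<Sum>k<N. \<Lambda> (B k) \<omega> *\<^sub>R v k)"
  proof eventually_elim
    case (elim \<omega>)
    have "simple_random_integral \<Lambda> UNIV (s i) \<omega> = (\<Sum>k<N. \<Lambda> (B k) \<omega> * v k $ i)" for i
    proof -
      have "\<Lambda> (snd (s i ! j)) \<omega> = (\<Sum>k<N. \<Lambda> (B k) \<omega> * (if k \<in> K (snd (s i ! j)) then 1 else 0))"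
        if j: "j < length (s i)" for j
      proof -
        have "(\<Sum>k<N. \<Lambda> (B k) \<omega> * (if k \<in> K (snd (s i ! j)) then 1 else 0)) =
            (\<Sum>k\<in>{..<N} \<inter> K (snd (s i ! j)). \<Lambda> (B k) \<omega>)"
          by (simp add: sum.inter_restrict if_distrib cong: if_cong)
        also have "{..<N} \<inter> K (snd (s i ! j)) = K (snd (s i ! j))"
          using K atom[OF j] by blast
        finally show ?thesis using elim atom[OF j] by simp
      qed
      then have "simple_random_integral \<Lambda> UNIV (s i) \<omega> = (\<Sum>j<length (s i). fst (s i ! j) *
          (\<Sum>k<N. \<Lambda> (B k) \<omega> * (if k \<in> K (snd (s i ! j)) then 1 else 0)))"
        by (simp add: simple_random_integral_def)
      also have "\<dots> = (\<Sum>k<N. \<Lambda> (B k) \<omega> * v k $ i)"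
        unfolding v_def by (simp add: sum_distrib_left mult.left_commute, subst sum.swap, simp)
      finally show ?thesis .
    qed
    then show ?case by (simp add: vec_eq_iff sum_component)
  qed
  have "distr M borel (\<lambda>\<omega>. (\<chi> i. simple_random_integral \<Lambda> UNIV (s i) \<omega>) :: real ^ 'n) =
      distr M borel (\<lambda>\<omega>. \<Sum>k<N. \<Lambda> (B k) \<omega> *\<^sub>R v k)"
    by (rule distr_cong_AE) (use eq in \<open>auto intro!: borel_measurable_vec_lambda\<close>)
  then show ?thesis
    using has_convolution_root_disjoint_combination[OF \<Lambda> B m] by simp
qed

section \<open>Infinite divisibility of the integral process\<close>

text \<open>Convergence in probability amounts to convergence to \<open>0\<close> of the expectations of \<open>min(1, |Y\<^sub>n - Z|)\<close>. Summing
over the finitely many coordinates gives one sequence converging in \<open>L\<^sup>1\<close>, and hence one subsequence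
along which all coordinates converge almost surely.\<close>

lemma (in prob_space) AE_convergent_subsequence:
  fixes Y :: "nat \<Rightarrow> 'n::finite \<Rightarrow> 'a \<Rightarrow> real"
  assumes [measurable]: "\<And>n i. Y n i \<in> borel_measurable M"
    and conv: "\<And>i. converges_in_probability M (\<lambda>n. Y n i) (Z i)"
  obtains r :: "nat \<Rightarrow> nat" where "strict_mono r"
    and "AE \<omega> in M. \<forall>i. (\<lambda>n. Y (r n) i \<omega>) \<longlonglongrightarrow> Z i \<omega>"
proof -
  have [measurable]: "Z i \<in> borel_measurable M" for i
    using conv by (simp add: converges_in_probability_def)
  define u where "u n \<omega> = (\<Sum>i\<in>UNIV. min 1 \<bar>Y n i \<omega> - Z i \<omega>\<bar>)" for n \<omega>
  have int: "integrable M (\<lambda>\<omega>. min 1 \<bar>Y n i \<omega> - Z i \<omega>\<bar>)" for n i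
    by (rule integrable_const_bound[where B = 1]) auto
  have lim: "(\<lambda>n. \<integral>\<omega>. min 1 \<bar>Y n i \<omega> - Z i \<omega>\<bar> \<partial>M) \<longlonglongrightarrow> 0" for i
  proof (rule LIMSEQ_I)
    fix \<epsilon> :: real assume \<epsilon>: "0 < \<epsilon>"
    let ?D = "\<lambda>n. {\<omega> \<in> space M. \<epsilon> / 2 < \<bar>Y n i \<omega> - Z i \<omega>\<bar>}"
    have "(\<lambda>n. prob (?D n)) \<longlonglongrightarrow> 0"
      using conv[of i] \<epsilon> unfolding converges_in_probability_def by (meson half_gt_zero)
    then have "\<forall>\<^sub>F n in sequentially. prob (?D n) < \<epsilon> / 2"
      using \<epsilon> by (intro order_tendstoD) auto
    then obtain n0 where n0: "\<And>n. n0 \<le> n \<Longrightarrow> prob (?D n) < \<epsilon> / 2"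
      by (auto simp: eventually_sequentially)
    have "norm ((\<integral>\<omega>. min 1 \<bar>Y n i \<omega> - Z i \<omega>\<bar> \<partial>M) - 0) < \<epsilon>" if "n0 \<le> n" for n
    proof -
      have "(\<integral>\<omega>. min 1 \<bar>Y n i \<omega> - Z i \<omega>\<bar> \<partial>M) \<le> (\<integral>\<omega>. \<epsilon> / 2 + indicator (?D n) \<omega> \<partial>M)"
      proof (rule integral_mono[OF int])
        show "integrable M (\<lambda>\<omega>. \<epsilon> / 2 + indicator (?D n) \<omega>)"
          by (intro Bochner_Integration.integrable_add integrable_real_indicator) (auto simp: emeasure_eq_measure)
      qed (use \<epsilon> in \<open>auto simp: indicator_def min_def\<close>)
      also have "\<dots> = \<epsilon> / 2 + prob (?D n)"
        by (subst Bochner_Integration.integral_add)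
          (auto simp: emeasure_eq_measure prob_space intro!: integrable_real_indicator)
      also have "\<dots> < \<epsilon>" using n0[OF that] by simp
      finally show ?thesis
        using integral_nonneg_AE[of "\<lambda>\<omega>. min 1 \<bar>Y n i \<omega> - Z i \<omega>\<bar>" M] by simp
    qed
    then show "\<exists>n0. \<forall>n\<ge>n0. norm ((\<integral>\<omega>. min 1 \<bar>Y n i \<omega> - Z i \<omega>\<bar> \<partial>M) - 0) < \<epsilon>" by blast
  qed
  have u_nonneg: "0 \<le> u n \<omega>" for n \<omega> by (simp add: u_def sum_nonneg)
  have u_int: "integrable M (u n)" for n
    unfolding u_def[abs_def] by (intro Bochner_Integration.integrable_sum int)
  have "(\<integral>\<omega>. norm (u n \<omega>) \<partial>M) = (\<Sum>i\<in>UNIV. \<integral>\<omega>. min 1 \<bar>Y n i \<omega> - Z i \<omega>\<bar> \<partial>M)" for n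
    using u_nonneg by (simp add: u_def Bochner_Integration.integral_sum[OF int])
  moreover have "(\<lambda>n. \<Sum>i\<in>UNIV. \<integral>\<omega>. min 1 \<bar>Y n i \<omega> - Z i \<omega>\<bar> \<partial>M) \<longlonglongrightarrow> 0"
    by (rule tendsto_null_sum) (rule lim)
  ultimately have "(\<lambda>n. \<integral>\<omega>. norm (u n \<omega>) \<partial>M) \<longlonglongrightarrow> 0" by simp
  then obtain r where r: "strict_mono r" and u_lim: "AE \<omega> in M. (\<lambda>n. u (r n) \<omega>) \<longlonglongrightarrow> 0"
    using tendsto_L1_AE_subseq[of M u] u_int by blast
  from u_lim have "AE \<omega> in M. \<forall>i. (\<lambda>n. Y (r n) i \<omega>) \<longlonglongrightarrow> Z i \<omega>"
  proof eventually_elim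
    case (elim \<omega>)
    show ?case
    proof
      fix i
      \<comment> \<open>Once \<open>u\<close> is below \<open>1\<close>, the truncation at \<open>1\<close> has no effect.\<close>
      have "\<forall>\<^sub>F n in sequentially. u (r n) \<omega> < 1"
        using elim by (rule order_tendstoD) simp
      then have "\<forall>\<^sub>F n in sequentially. norm (Y (r n) i \<omega> - Z i \<omega>) \<le> u (r n) \<omega>"
      proof eventually_elim
        case (elim n)
        have "min 1 \<bar>Y (r n) i \<omega> - Z i \<omega>\<bar> \<le> u (r n) \<omega>"
          unfolding u_def by (rule member_le_sum) auto
        then show ?case using elim by simp
      qed
      then have "(\<lambda>n. Y (r n) i \<omega> - Z i \<omega>) \<longlonglongrightarrow> 0"
        using elim by (rule Lim_null_comparison)
      then show "(\<lambda>n. Y (r n) i \<omega>) \<longlonglongrightarrow> Z i \<omega>" by (simp add: LIM_zero_iff)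
    qed
  qed
  with r show ?thesis by (rule that)
qed

theorem theorem2p1:
  fixes M :: "'w measure"
    and \<Lambda> :: "(real ^ 'd) set \<Rightarrow> 'w \<Rightarrow> real"
    and f :: "real ^ 'q \<Rightarrow> real ^ 'd \<Rightarrow> real"
    and X :: "real ^ 'q \<Rightarrow> 'w \<Rightarrow> real"
    and ts :: "'n::finite \<Rightarrow> real ^ 'q"
  assumes "infinitely_divisible_random_measure M \<Lambda>"
    and "\<And>t. random_integrable M \<Lambda> (f t)"
    and "\<And>t. has_random_integral M \<Lambda> (f t) (X t)"
  shows "infinitely_divisible (distr M borel (\<lambda>\<omega>. (\<chi> i. X (ts i) \<omega>) :: real ^ 'n))"
proof -
  note \<Lambda> = assms(1)
  interpret prob_space M by (rule infinitely_divisible_random_measureD(1)[OF \<Lambda>])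
  have "\<exists>s. approximating_sequence M \<Lambda> (f (ts i)) s \<and>
      converges_in_probability M (\<lambda>n. simple_random_integral \<Lambda> UNIV (s n)) (X (ts i))" for i
    using assms(3) unfolding has_random_integral_def by blast
  then obtain s where approx: "\<And>i. approximating_sequence M \<Lambda> (f (ts i)) (s i)"
    and conv: "\<And>i. converges_in_probability M (\<lambda>n. simple_random_integral \<Lambda> UNIV (s i n)) (X (ts i))"
    by metis
  have simple: "is_simple (s i n)" for i n
    using approx unfolding approximating_sequence_def by blast
  have [measurable]: "simple_random_integral \<Lambda> UNIV (s i n) \<in> borel_measurable M" for i n
    by (rule simple_random_integral_measurable[OF \<Lambda> simple])
  have [measurable]: "X (ts i) \<in> borel_measurable M" for i
    using conv by (simp add: converges_in_probability_def)
  obtain r where r: "AE \<omega> in M. \<forall>i. (\<lambda>n. simple_random_integral \<Lambda> UNIV (s i (r n)) \<omega>) \<longlonglongrightarrow> X (ts i) \<omega>"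
    by (rule AE_convergent_subsequence[of "\<lambda>n i. simple_random_integral \<Lambda> UNIV (s i n)" "\<lambda>i. X (ts i)"])
      (use conv in auto)
  let ?V = "\<lambda>n \<omega>. (\<chi> i. simple_random_integral \<Lambda> UNIV (s i (r n)) \<omega>) :: real ^ 'n"
  let ?W = "\<lambda>\<omega>. (\<chi> i. X (ts i) \<omega>) :: real ^ 'n"
  have V: "?V n \<in> borel_measurable M" for n by (intro borel_measurable_vec_lambda) measurable
  have W: "?W \<in> borel_measurable M" by (intro borel_measurable_vec_lambda) measurable
  have lim: "AE \<omega> in M. (\<lambda>n. ?V n \<omega>) \<longlonglongrightarrow> ?W \<omega>"
    using r by eventually_elim (auto intro!: tendsto_vec_lambda)
  have "has_convolution_root m (distr M borel ?W)" if "1 \<le> m" for m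
    using V W lim has_convolution_root_simple_random_integrals[OF \<Lambda> simple that] that
    by (rule has_convolution_root_AE_limit)
  then show ?thesis
    unfolding infinitely_divisible_def has_convolution_root_def
    using prob_space_distr[OF W] by simp
qed

end
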